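(* There exists a quasi-Kähler structure $(g_0,J_0,\omega_0)$ on the Iwasawa manifold with the following properties: 1. the Hermitian curvature tensor of $(g_0,J_0)$ vanishes; 2. the Riemann curvature tensor $R$ of $g_0$ satisfies the second Gray identity: $R(Z_1,Z_2,Z_3,Z_4)=R(\overline{Z}_1,Z_2,Z_3,Z_4)=0$ for every $(1,0)$-vector fields $Z_1,Z_2,Z_3,Z_4$ (with respect to $J_0$).
   Context: The Iwasawa manifold is the compact smooth 6-manifold $M=G/\Gamma$, where $G$ is the complex Heisenberg group of matrices $\begin{pmatrix}1&z_1&z_2\\0&1&z_3\\0&0&1\end{pmatrix}$, $z_i\in\mathbb{C}$, and $\Gamma$ is the cocompact lattice of such matrices with (Gaussian) integral entries. An almost Hermitian structure $(g,J,\omega)$ on $M$ consists of an almost complex structure $J$, a Riemannian metric $g$ preserved by $J$, and the 2-form $\omega(\cdot,\cdot)=g(J\cdot,\cdot)$. $T^{1,0}M$ is the $i$-eigenbundle of $J$ on $TM\otimes\mathbb{C}$; $(1,0)$-vector fields are its sections; all tensors and connections are extended complex-(multi)linearly. The structure is quasi-Kähler if $\overline\partial\omega=(d\omega)^{1,2}=0$. Let $\nabla$ be the Levi-Civita connection of $g$ and $R(X,Y,Z,W)=g(\nabla_X\nabla_YZ-\nabla_Y\nabla_XZ-\nabla_{[X,Y]}Z,W)$. The canonical connection $\widetilde\nabla$ is the unique linear connection with $\widetilde\nabla g=0$, $\widetilde\nabla J=0$ and vanishing $(1,1)$-part of the torsion; in the quasi-Kähler case $\widetilde\nabla_XY=\nabla_XY-\frac12J(\nabla_XJ)Y$.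 The Hermitian curvature tensor is $\widetilde R(X,Y,Z,W)=g(\widetilde\nabla_X\widetilde\nabla_YZ-\widetilde\nabla_Y\widetilde\nabla_XZ-\widetilde\nabla_{[X,Y]}Z,W)$. *)

theory Defs
  imports "HOL-Analysis.Analysis" "HOL-Library.Function_Algebras"
begin

section \<open>Smooth maps between Euclidean spaces\<close>

text \<open>Meant for an open set: all iterated directional derivatives exist and are continuous.\<close>

primrec Ck_on :: "nat \<Rightarrow> 'a::euclidean_space set \<Rightarrow> ('a \<Rightarrow> 'b::real_normed_vector) \<Rightarrow> bool" where
  "Ck_on 0 S f \<longleftrightarrow> continuous_on S f"
| "Ck_on (Suc n) S f \<longleftrightarrow>
     (\<forall>x\<in>S. f differentiable (at x)) \<and> (\<forall>v. Ck_on n S (\<lambda>x. frechet_derivative f (at x) v))"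

definition smooth_on :: "'a::euclidean_space set \<Rightarrow> ('a \<Rightarrow> 'b::real_normed_vector) \<Rightarrow> bool" where
  "smooth_on S f \<longleftrightarrow> (\<forall>n. Ck_on n S f)"


section \<open>Manifolds given by an atlas\<close>

text \<open>A chart on the point type \<open>'m\<close> is a pair \<open>(U, \<phi>)\<close>, where \<open>\<phi>\<close> is relevant on \<open>U\<close> only.\<close>

type_synonym ('m, 'e) chart = "'m set \<times> ('m \<Rightarrow> 'e)"

definition chart_inv :: "('m, 'e) chart \<Rightarrow> 'e \<Rightarrow> 'm" where
  "chart_inv c = inv_into (fst c) (snd c)"

definition smooth_atlas :: "('m, 'e::euclidean_space) chart set \<Rightarrow> bool" where
  "smooth_atlas A \<longleftrightarrow>
     (\<Union>c\<in>A. fst c) = UNIV \<and>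
     (\<forall>c\<in>A. inj_on (snd c) (fst c) \<and> open (snd c ` fst c)) \<and>
     (\<forall>c\<in>A. \<forall>d\<in>A. open (snd c ` (fst c \<inter> fst d)) \<and>
        smooth_on (snd c ` (fst c \<inter> fst d)) (snd d \<circ> chart_inv c))"

definition smooth_fun :: "('m, 'e::euclidean_space) chart set \<Rightarrow> ('m \<Rightarrow> real) \<Rightarrow> bool" where
  "smooth_fun A f \<longleftrightarrow> (\<forall>c\<in>A. smooth_on (snd c ` fst c) (f \<circ> chart_inv c))"

text \<open>
  A vector field \<open>X\<close> is represented by its components: \<open>X c x\<close> is the coordinate vector
  of \<open>X\<close> at the point \<open>x\<close> with respect to the chart \<open>c\<close>. The components are smooth and
  transform by the derivative of the change of charts. The value \<open>0\<close> where \<open>c\<close> is not a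
  chart around \<open>x\<close> makes equality of vector fields the equality of HOL.
\<close>

type_synonym ('m, 'e) field = "('m, 'e) chart \<Rightarrow> 'm \<Rightarrow> 'e"

definition vfields :: "('m, 'e::euclidean_space) chart set \<Rightarrow> ('m, 'e) field set" where
  "vfields A = {X.
     (\<forall>c x. c \<notin> A \<or> x \<notin> fst c \<longrightarrow> X c x = 0) \<and>
     (\<forall>c\<in>A. smooth_on (snd c ` fst c) (X c \<circ> chart_inv c)) \<and>
     (\<forall>c\<in>A. \<forall>d\<in>A. \<forall>x \<in> fst c \<inter> fst d.
        X d x = frechet_derivative (snd d \<circ> chart_inv c) (at (snd c x)) (X c x))}"

definition fscale :: "('m \<Rightarrow> real) \<Rightarrow> ('m, 'e::euclidean_space) field \<Rightarrow> ('m, 'e) field" where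
  "fscale f X = (\<lambda>c x. f x *\<^sub>R X c x)"

text \<open>The function \<open>X f\<close>; for a vector field the value does not depend on the chosen chart.\<close>

definition vderiv ::
  "('m, 'e::euclidean_space) chart set \<Rightarrow> ('m, 'e) field \<Rightarrow> ('m \<Rightarrow> real) \<Rightarrow> 'm \<Rightarrow> real" where
  "vderiv A X f x =
     (let c = (SOME c. c \<in> A \<and> x \<in> fst c)
      in frechet_derivative (f \<circ> chart_inv c) (at (snd c x)) (X c x))"

definition bracket ::
  "('m, 'e::euclidean_space) chart set \<Rightarrow> ('m, 'e) field \<Rightarrow> ('m, 'e) field \<Rightarrow> ('m, 'e) field" where
  "bracket A X Y = (\<lambda>c x. if c \<in> A \<and> x \<in> fst c
     then frechet_derivative (Y c \<circ> chart_inv c) (at (snd c x)) (X c x)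
        - frechet_derivative (X c \<circ> chart_inv c) (at (snd c x)) (Y c x)
     else 0)"


section \<open>Metrics, almost complex structures, connections\<close>

text \<open>
  Tensor fields are the maps on vector fields that are multilinear over the smooth
  functions. Their values on arguments outside \<open>vfields A\<close> carry no information.
\<close>

definition riemannian_metric ::
  "('m, 'e::euclidean_space) chart set \<Rightarrow> (('m, 'e) field \<Rightarrow> ('m, 'e) field \<Rightarrow> 'm \<Rightarrow> real) \<Rightarrow> bool" where
  "riemannian_metric A g \<longleftrightarrow>
     (\<forall>X\<in>vfields A. \<forall>Y\<in>vfields A. smooth_fun A (g X Y) \<and> g X Y = g Y X) \<and>
     (\<forall>X\<in>vfields A. \<forall>Y\<in>vfields A. \<forall>Z\<in>vfields A. g (X + Y) Z = g X Z + g Y Z) \<and>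
     (\<forall>f X Y. smooth_fun A f \<and> X \<in> vfields A \<and> Y \<in> vfields A \<longrightarrow> g (fscale f X) Y = f * g X Y) \<and>
     (\<forall>X\<in>vfields A. \<forall>c\<in>A. \<forall>x\<in>fst c. X c x \<noteq> 0 \<longrightarrow> g X X x > 0)"

definition almost_complex ::
  "('m, 'e::euclidean_space) chart set \<Rightarrow> (('m, 'e) field \<Rightarrow> ('m, 'e) field) \<Rightarrow> bool" where
  "almost_complex A J \<longleftrightarrow>
     (\<forall>X\<in>vfields A. J X \<in> vfields A \<and> J (J X) = - X) \<and>
     (\<forall>X\<in>vfields A. \<forall>Y\<in>vfields A. J (X + Y) = J X + J Y) \<and>
     (\<forall>f X. smooth_fun A f \<and> X \<in> vfields A \<longrightarrow> J (fscale f X) = fscale f (J X))"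

definition almost_hermitian ::
  "('m, 'e::euclidean_space) chart set \<Rightarrow> (('m, 'e) field \<Rightarrow> ('m, 'e) field \<Rightarrow> 'm \<Rightarrow> real) \<Rightarrow>
   (('m, 'e) field \<Rightarrow> ('m, 'e) field) \<Rightarrow> (('m, 'e) field \<Rightarrow> ('m, 'e) field \<Rightarrow> 'm \<Rightarrow> real) \<Rightarrow> bool" where
  "almost_hermitian A g J \<omega> \<longleftrightarrow>
     riemannian_metric A g \<and> almost_complex A J \<and>
     (\<forall>X\<in>vfields A. \<forall>Y\<in>vfields A. g (J X) (J Y) = g X Y) \<and>
     (\<forall>X\<in>vfields A. \<forall>Y\<in>vfields A. \<omega> X Y = g (J X) Y)"

text \<open>Exterior derivative of a 2-form, without a normalising factor.\<close>

definition ext_deriv2 ::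
  "('m, 'e::euclidean_space) chart set \<Rightarrow> (('m, 'e) field \<Rightarrow> ('m, 'e) field \<Rightarrow> 'm \<Rightarrow> real) \<Rightarrow>
   ('m, 'e) field \<Rightarrow> ('m, 'e) field \<Rightarrow> ('m, 'e) field \<Rightarrow> 'm \<Rightarrow> real" where
  "ext_deriv2 A \<omega> X Y Z =
     vderiv A X (\<omega> Y Z) - vderiv A Y (\<omega> X Z) + vderiv A Z (\<omega> X Y)
     - \<omega> (bracket A X Y) Z + \<omega> (bracket A X Z) Y - \<omega> (bracket A Y Z) X"

definition linear_connection ::
  "('m, 'e::euclidean_space) chart set \<Rightarrow> (('m, 'e) field \<Rightarrow> ('m, 'e) field \<Rightarrow> ('m, 'e) field) \<Rightarrow> bool" where
  "linear_connection A D \<longleftrightarrow>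
     (\<forall>X\<in>vfields A. \<forall>Y\<in>vfields A. D X Y \<in> vfields A) \<and>
     (\<forall>X\<in>vfields A. \<forall>Y\<in>vfields A. \<forall>Z\<in>vfields A.
        D (X + Y) Z = D X Z + D Y Z \<and> D X (Y + Z) = D X Y + D X Z) \<and>
     (\<forall>f X Y. smooth_fun A f \<and> X \<in> vfields A \<and> Y \<in> vfields A \<longrightarrow>
        D (fscale f X) Y = fscale f (D X Y) \<and>
        D X (fscale f Y) = fscale (vderiv A X f) Y + fscale f (D X Y))"

definition parallel_metric ::
  "('m, 'e::euclidean_space) chart set \<Rightarrow> (('m, 'e) field \<Rightarrow> ('m, 'e) field \<Rightarrow> 'm \<Rightarrow> real) \<Rightarrow>
   (('m, 'e) field \<Rightarrow> ('m, 'e) field \<Rightarrow> ('m, 'e) field) \<Rightarrow> bool" where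
  "parallel_metric A g D \<longleftrightarrow> (\<forall>X\<in>vfields A. \<forall>Y\<in>vfields A. \<forall>Z\<in>vfields A.
     vderiv A X (g Y Z) = g (D X Y) Z + g Y (D X Z))"

definition parallel_acs ::
  "('m, 'e::euclidean_space) chart set \<Rightarrow> (('m, 'e) field \<Rightarrow> ('m, 'e) field) \<Rightarrow>
   (('m, 'e) field \<Rightarrow> ('m, 'e) field \<Rightarrow> ('m, 'e) field) \<Rightarrow> bool" where
  "parallel_acs A J D \<longleftrightarrow> (\<forall>X\<in>vfields A. \<forall>Y\<in>vfields A. D X (J Y) = J (D X Y))"

definition torsion ::
  "('m, 'e::euclidean_space) chart set \<Rightarrow> (('m, 'e) field \<Rightarrow> ('m, 'e) field \<Rightarrow> ('m, 'e) field) \<Rightarrow>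
   ('m, 'e) field \<Rightarrow> ('m, 'e) field \<Rightarrow> ('m, 'e) field" where
  "torsion A D X Y = D X Y - D Y X - bracket A X Y"

definition curvature ::
  "('m, 'e::euclidean_space) chart set \<Rightarrow> (('m, 'e) field \<Rightarrow> ('m, 'e) field \<Rightarrow> 'm \<Rightarrow> real) \<Rightarrow>
   (('m, 'e) field \<Rightarrow> ('m, 'e) field \<Rightarrow> ('m, 'e) field) \<Rightarrow>
   ('m, 'e) field \<Rightarrow> ('m, 'e) field \<Rightarrow> ('m, 'e) field \<Rightarrow> ('m, 'e) field \<Rightarrow> 'm \<Rightarrow> real" where
  "curvature A g D X Y Z W = g (D X (D Y Z) - D Y (D X Z) - D (bracket A X Y) Z) W"

text \<open>
  This determines \<open>D\<close> on \<open>vfields A\<close>; likewise for the canonical connection below.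
\<close>

definition levi_civita ::
  "('m, 'e::euclidean_space) chart set \<Rightarrow> (('m, 'e) field \<Rightarrow> ('m, 'e) field \<Rightarrow> 'm \<Rightarrow> real) \<Rightarrow>
   (('m, 'e) field \<Rightarrow> ('m, 'e) field \<Rightarrow> ('m, 'e) field) \<Rightarrow> bool" where
  "levi_civita A g D \<longleftrightarrow> linear_connection A D \<and> parallel_metric A g D \<and>
     (\<forall>X\<in>vfields A. \<forall>Y\<in>vfields A. torsion A D X Y = 0)"


section \<open>Complexification and types\<close>

text \<open>A pair \<open>(X, Y)\<close> of vector fields stands for the section \<open>X + iY\<close> of \<open>TM \<otimes> \<complex>\<close>.\<close>

type_synonym ('m, 'e) cfield = "('m, 'e) field \<times> ('m, 'e) field"

definition cvfields :: "('m, 'e::euclidean_space) chart set \<Rightarrow> ('m, 'e) cfield set" where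
  "cvfields A = vfields A \<times> vfields A"

definition mult_i :: "('m, 'e::euclidean_space) cfield \<Rightarrow> ('m, 'e) cfield" where
  "mult_i Z = (- snd Z, fst Z)"

definition conj_field :: "('m, 'e::euclidean_space) cfield \<Rightarrow> ('m, 'e) cfield" where
  "conj_field Z = (fst Z, - snd Z)"

text \<open>Complex-linear extension of a map on real vector fields, scalar- and field-valued.\<close>

definition extend :: "(('m, 'e) field \<Rightarrow> complex) \<Rightarrow> ('m, 'e) cfield \<Rightarrow> complex" where
  "extend h Z = h (fst Z) + \<i> * h (snd Z)"

definition extend_field ::
  "(('m, 'e) field \<Rightarrow> ('m, 'e::euclidean_space) cfield) \<Rightarrow> ('m, 'e) cfield \<Rightarrow> ('m, 'e) cfield" where
  "extend_field h Z = h (fst Z) + mult_i (h (snd Z))"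

definition extend_acs ::
  "(('m, 'e) field \<Rightarrow> ('m, 'e::euclidean_space) field) \<Rightarrow> ('m, 'e) cfield \<Rightarrow> ('m, 'e) cfield" where
  "extend_acs J = extend_field (\<lambda>X. (J X, 0))"

definition extend_bilinear ::
  "(('m, 'e) field \<Rightarrow> ('m, 'e) field \<Rightarrow> ('m, 'e::euclidean_space) field) \<Rightarrow>
   ('m, 'e) cfield \<Rightarrow> ('m, 'e) cfield \<Rightarrow> ('m, 'e) cfield" where
  "extend_bilinear T Z1 Z2 = extend_field (\<lambda>X. extend_field (\<lambda>Y. (T X Y, 0)) Z2) Z1"

definition extend3 ::
  "(('m, 'e) field \<Rightarrow> ('m, 'e) field \<Rightarrow> ('m, 'e) field \<Rightarrow> 'm \<Rightarrow> real) \<Rightarrow>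
   ('m, 'e) cfield \<Rightarrow> ('m, 'e) cfield \<Rightarrow> ('m, 'e) cfield \<Rightarrow> 'm \<Rightarrow> complex" where
  "extend3 \<alpha> Z1 Z2 Z3 x =
     extend (\<lambda>X1. extend (\<lambda>X2. extend (\<lambda>X3. of_real (\<alpha> X1 X2 X3 x)) Z3) Z2) Z1"

definition extend4 ::
  "(('m, 'e) field \<Rightarrow> ('m, 'e) field \<Rightarrow> ('m, 'e) field \<Rightarrow> ('m, 'e) field \<Rightarrow> 'm \<Rightarrow> real) \<Rightarrow>
   ('m, 'e) cfield \<Rightarrow> ('m, 'e) cfield \<Rightarrow> ('m, 'e) cfield \<Rightarrow> ('m, 'e) cfield \<Rightarrow> 'm \<Rightarrow> complex" where
  "extend4 \<alpha> Z1 Z2 Z3 Z4 x =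
     extend (\<lambda>X1. extend (\<lambda>X2. extend (\<lambda>X3. extend (\<lambda>X4. of_real (\<alpha> X1 X2 X3 X4 x)) Z4) Z3) Z2) Z1"

definition vfields10 ::
  "('m, 'e::euclidean_space) chart set \<Rightarrow> (('m, 'e) field \<Rightarrow> ('m, 'e) field) \<Rightarrow> ('m, 'e) cfield set" where
  "vfields10 A J = {Z \<in> cvfields A. extend_acs J Z = mult_i Z}"

text \<open>The projections \<open>(Z - i J Z)/2\<close> and \<open>(Z + i J Z)/2\<close> onto the two eigenbundles.\<close>

definition half :: "('m, 'e::euclidean_space) cfield \<Rightarrow> ('m, 'e) cfield" where
  "half Z = (fscale (\<lambda>_. 1 / 2) (fst Z), fscale (\<lambda>_. 1 / 2) (snd Z))"

definition proj10 ::
  "(('m, 'e) field \<Rightarrow> ('m, 'e::euclidean_space) field) \<Rightarrow> ('m, 'e) cfield \<Rightarrow> ('m, 'e) cfield" where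
  "proj10 J Z = half (Z - mult_i (extend_acs J Z))"

definition proj01 ::
  "(('m, 'e) field \<Rightarrow> ('m, 'e::euclidean_space) field) \<Rightarrow> ('m, 'e) cfield \<Rightarrow> ('m, 'e) cfield" where
  "proj01 J Z = half (Z + mult_i (extend_acs J Z))"

text \<open>The component of type (1,2) of a 3-form, and of type (1,1) of a vector-valued 2-form.\<close>

definition part12 ::
  "(('m, 'e) field \<Rightarrow> ('m, 'e::euclidean_space) field) \<Rightarrow>
   (('m, 'e) field \<Rightarrow> ('m, 'e) field \<Rightarrow> ('m, 'e) field \<Rightarrow> 'm \<Rightarrow> real) \<Rightarrow>
   ('m, 'e) cfield \<Rightarrow> ('m, 'e) cfield \<Rightarrow> ('m, 'e) cfield \<Rightarrow> 'm \<Rightarrow> complex" where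
  "part12 J \<alpha> Z1 Z2 Z3 x =
     extend3 \<alpha> (proj10 J Z1) (proj01 J Z2) (proj01 J Z3) x +
     extend3 \<alpha> (proj01 J Z1) (proj10 J Z2) (proj01 J Z3) x +
     extend3 \<alpha> (proj01 J Z1) (proj01 J Z2) (proj10 J Z3) x"

definition part11 ::
  "(('m, 'e) field \<Rightarrow> ('m, 'e::euclidean_space) field) \<Rightarrow>
   (('m, 'e) field \<Rightarrow> ('m, 'e) field \<Rightarrow> ('m, 'e) field) \<Rightarrow>
   ('m, 'e) cfield \<Rightarrow> ('m, 'e) cfield \<Rightarrow> ('m, 'e) cfield" where
  "part11 J T Z1 Z2 =
     extend_bilinear T (proj10 J Z1) (proj01 J Z2) +
     extend_bilinear T (proj01 J Z1) (proj10 J Z2)"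

definition quasi_kaehler ::
  "('m, 'e::euclidean_space) chart set \<Rightarrow> (('m, 'e) field \<Rightarrow> ('m, 'e) field \<Rightarrow> 'm \<Rightarrow> real) \<Rightarrow>
   (('m, 'e) field \<Rightarrow> ('m, 'e) field) \<Rightarrow> (('m, 'e) field \<Rightarrow> ('m, 'e) field \<Rightarrow> 'm \<Rightarrow> real) \<Rightarrow> bool" where
  "quasi_kaehler A g J \<omega> \<longleftrightarrow> almost_hermitian A g J \<omega> \<and>
     (\<forall>Z1\<in>cvfields A. \<forall>Z2\<in>cvfields A. \<forall>Z3\<in>cvfields A. \<forall>x.
        part12 J (ext_deriv2 A \<omega>) Z1 Z2 Z3 x = 0)"

definition canonical_connection ::
  "('m, 'e::euclidean_space) chart set \<Rightarrow> (('m, 'e) field \<Rightarrow> ('m, 'e) field \<Rightarrow> 'm \<Rightarrow> real) \<Rightarrow>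
   (('m, 'e) field \<Rightarrow> ('m, 'e) field) \<Rightarrow>
   (('m, 'e) field \<Rightarrow> ('m, 'e) field \<Rightarrow> ('m, 'e) field) \<Rightarrow> bool" where
  "canonical_connection A g J D \<longleftrightarrow>
     linear_connection A D \<and> parallel_metric A g D \<and> parallel_acs A J D \<and>
     (\<forall>Z1\<in>cvfields A. \<forall>Z2\<in>cvfields A. part11 J (torsion A D) Z1 Z2 = 0)"


section \<open>The Iwasawa manifold\<close>

definition heis :: "complex \<times> complex \<times> complex \<Rightarrow> complex^3^3" where
  "heis z = (case z of (z1, z2, z3) \<Rightarrow>
     vector [vector [1, z1, z2], vector [0, 1, z3], vector [0, 0, 1]])"

definition heis_group :: "(complex^3^3) set" where
  "heis_group = range heis"

definition heis_lattice :: "(complex^3^3) set" where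
  "heis_lattice = {h \<in> heis_group. \<forall>i j. Re (h $ i $ j) \<in> \<int> \<and> Im (h $ i $ j) \<in> \<int>}"

text \<open>The points of \<open>G/\<Gamma>\<close> are the cosets \<open>h\<Gamma>\<close>.\<close>

definition heis_coset :: "complex^3^3 \<Rightarrow> (complex^3^3) set" where
  "heis_coset h = {h ** \<gamma> | \<gamma>. \<gamma> \<in> heis_lattice}"

typedef iwasawa = "heis_coset ` heis_group"
  unfolding heis_group_def by blast

definition iwasawa_proj :: "complex \<times> complex \<times> complex \<Rightarrow> iwasawa" where
  "iwasawa_proj z = Abs_iwasawa (heis_coset (heis z))"

text \<open>The charts are the inverses of the quotient map on open sets where it is injective.\<close>

definition iwasawa_atlas :: "(iwasawa, complex \<times> complex \<times> complex) chart set" where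
  "iwasawa_atlas =
     {(iwasawa_proj ` V, inv_into V iwasawa_proj) | V. open V \<and> inj_on iwasawa_proj V}"


text \<open>The charts do form an atlas: changes of charts are locally right translations by \<open>\<Gamma>\<close>.\<close>

definition gauss_int :: "complex set" where
  "gauss_int = {a. Re a \<in> \<int> \<and> Im a \<in> \<int>}"

fun heis_mult :: "complex \<times> complex \<times> complex \<Rightarrow> complex \<times> complex \<times> complex \<Rightarrow>
    complex \<times> complex \<times> complex" where
  "heis_mult (z1, z2, z3) (w1, w2, w3) = (z1 + w1, w2 + z1 * w3 + z2, z3 + w3)"

lemma heis_mult: "heis z ** heis w = heis (heis_mult z w)"
  by (cases z; cases w)
    (simp add: heis_def matrix_matrix_mult_def vec_eq_iff forall_3 sum_3 algebra_simps)

lemma inj_heis: "heis z = heis w \<longleftrightarrow> z = w"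
  by (cases z; cases w) (auto simp: heis_def vec_eq_iff forall_3)

lemma heis_lattice_iff: "heis (a, b, c) \<in> heis_lattice \<longleftrightarrow> a \<in> gauss_int \<and> b \<in> gauss_int \<and> c \<in> gauss_int"
proof -
  have "heis (a, b, c) \<in> heis_group" by (simp add: heis_group_def)
  then show ?thesis
    by (auto simp: heis_lattice_def heis_def gauss_int_def forall_3)
qed

lemma heis_lattice_eq: "heis_lattice = heis ` (gauss_int \<times> gauss_int \<times> gauss_int)"
proof -
  have "\<exists>a b c. h = heis (a, b, c)" if "h \<in> heis_lattice" for h
    using that by (auto simp: heis_lattice_def heis_group_def)
  then show ?thesis
    using heis_lattice_iff by blast
qed

lemma gauss_int_closed:
  "a \<in> gauss_int \<Longrightarrow> b \<in> gauss_int \<Longrightarrow> a + b \<in> gauss_int"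
  "a \<in> gauss_int \<Longrightarrow> b \<in> gauss_int \<Longrightarrow> a * b \<in> gauss_int"
  "a \<in> gauss_int \<Longrightarrow> - a \<in> gauss_int"
  "a \<in> gauss_int \<Longrightarrow> b \<in> gauss_int \<Longrightarrow> a - b \<in> gauss_int" "0 \<in> gauss_int"
  by (auto simp: gauss_int_def)

lemma heis_coset_eq: "heis_coset (heis z) = (\<lambda>c. heis (heis_mult z c)) ` (gauss_int \<times> gauss_int \<times> gauss_int)"
  unfolding heis_coset_def heis_lattice_eq by (force simp: heis_mult[symmetric])

lemma heis_mult_assoc: "heis_mult (heis_mult u v) w = heis_mult u (heis_mult v w)"
  by (cases u; cases v; cases w) (simp add: algebra_simps)

lemma iwasawa_proj_eq_iff:
  "iwasawa_proj z = iwasawa_proj w \<longleftrightarrow>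
     (\<exists>c \<in> gauss_int \<times> gauss_int \<times> gauss_int. w = heis_mult z c)" (is "_ \<longleftrightarrow> ?R")
proof -
  let ?L = "gauss_int \<times> gauss_int \<times> gauss_int"
  have closed: "heis_mult c d \<in> ?L" if "c \<in> ?L" "d \<in> ?L" for c d
    using that by (cases c; cases d) (auto intro!: gauss_int_closed)
  have inv: "\<exists>d \<in> ?L. z = heis_mult (heis_mult z c) d" if "c \<in> ?L" for c z
  proof -
    obtain a b e where c: "c = (a, b, e)" by (cases c)
    show ?thesis
      using that unfolding c
      by (intro bexI[of _ "(- a, a * e + - b, - e)"], cases z)
        (simp_all add: algebra_simps gauss_int_closed)
  qed
  have "iwasawa_proj z = iwasawa_proj w \<longleftrightarrow> heis_coset (heis z) = heis_coset (heis w)"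
    by (simp add: iwasawa_proj_def Abs_iwasawa_inject heis_group_def)
  also have "\<dots> \<longleftrightarrow> ?R"
  proof
    assume eq: "heis_coset (heis z) = heis_coset (heis w)"
    have "heis w \<in> heis_coset (heis w)"
      unfolding heis_coset_eq
      by (rule image_eqI[of _ _ "(0, 0, 0)"]) (cases w, auto intro: gauss_int_closed)
    then show ?R
      unfolding eq[symmetric] unfolding heis_coset_eq by (auto simp only: inj_heis)
  next
    assume ?R
    then obtain c where c: "c \<in> ?L" "w = heis_mult z c" by blast
    obtain d where d: "d \<in> ?L" "z = heis_mult w d" using inv[OF c(1), of z] c(2) by blast
    show "heis_coset (heis z) = heis_coset (heis w)"
    proof
      show "heis_coset (heis z) \<subseteq> heis_coset (heis w)"
        unfolding heis_coset_eq using closed[OF d(1)] d(2) heis_mult_assoc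
        by (metis (no_types, lifting) image_eqI image_subsetI)
      show "heis_coset (heis w) \<subseteq> heis_coset (heis z)"
        unfolding heis_coset_eq using closed[OF c(1)] c(2) heis_mult_assoc
        by (metis (no_types, lifting) image_eqI image_subsetI)
    qed
  qed
  finally show ?thesis .
qed

lemma gauss_int_small: "a \<in> gauss_int \<Longrightarrow> norm a < 1 \<Longrightarrow> a = 0"
proof -
  assume a: "a \<in> gauss_int" "norm a < 1"
  have "\<bar>Re a\<bar> < 1" "\<bar>Im a\<bar> < 1"
    using a(2) abs_Re_le_cmod[of a] abs_Im_le_cmod[of a] by linarith+
  then show "a = 0"
    using a(1) by (auto simp: gauss_int_def complex_eq_iff elim!: Ints_cases)
qed

lemma inj_on_iwasawa_proj_ball: "inj_on iwasawa_proj (ball p (1 / 2))"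
proof (rule inj_onI)
  fix z w assume zw: "z \<in> ball p (1 / 2)" "w \<in> ball p (1 / 2)" "iwasawa_proj z = iwasawa_proj w"
  obtain c where c: "c \<in> gauss_int \<times> gauss_int \<times> gauss_int" "w = heis_mult z c"
    using zw(3) iwasawa_proj_eq_iff by blast
  obtain a b e z1 z2 z3 where d: "c = (a, b, e)" "z = (z1, z2, z3)" by (cases c; cases z)
  have "dist z w < 1"
    using zw dist_triangle_half_r[of p z 1 w] by simp
  then have n: "norm (w - z) < 1"
    by (simp add: dist_norm norm_minus_commute)
  have wz: "w - z = (a, b + z1 * e, e)"
    by (simp add: c d)
  have "norm a \<le> norm (w - z)" "norm e \<le> norm (w - z)" "norm (b + z1 * e) \<le> norm (w - z)"
    unfolding wz using norm_fst_le[of a "(b + z1 * e, e)"] norm_snd_le[of "(b + z1 * e, e)" a]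
      norm_fst_le[of "b + z1 * e" e] norm_snd_le[of e "b + z1 * e"]
    by linarith+
  then have "a = 0" "e = 0" "b + z1 * e = 0 \<or> norm (b + z1 * e) < 1"
    using n c d gauss_int_small by auto
  then have "b = 0" using c d gauss_int_small by auto
  with \<open>a = 0\<close> \<open>e = 0\<close> show "z = w" by (simp add: c d)
qed

lemma Ck_on_const: "Ck_on n S (\<lambda>x. k)"
  by (induction n arbitrary: k) auto

lemma Ck_on_affine:
  assumes "bounded_linear L"
  shows "Ck_on n S (\<lambda>x. L x + b)"
proof -
  have der: "((\<lambda>x. L x + b) has_derivative L) (at x)" for x
    using assms by (auto intro!: derivative_eq_intros bounded_linear_imp_has_derivative)
  then have "frechet_derivative (\<lambda>x. L x + b) (at x) = L" for x
    by (metis frechet_derivative_at)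
  moreover have "continuous_on S (\<lambda>x. L x + b)"
    by (intro continuous_at_imp_continuous_on ballI has_derivative_continuous[OF der])
  ultimately show ?thesis
    using der by (cases n) (auto simp: Ck_on_const differentiable_def)
qed

lemma Ck_on_local:
  assumes "\<And>x. x \<in> S \<Longrightarrow> \<exists>T h. open T \<and> x \<in> T \<and> Ck_on n T h \<and> (\<forall>y\<in>T. f y = h y)"
  shows "Ck_on n S f"
  using assms
proof (induction n arbitrary: f)
  case 0
  have "isCont f x" if x: "x \<in> S" for x
  proof -
    obtain T h where T: "open T" "x \<in> T" "continuous_on T h" "\<forall>y\<in>T. f y = h y"
      using 0[OF x] by auto
    then have "continuous_on T f" by (simp cong: continuous_on_cong)
    then show ?thesis using T continuous_on_eq_continuous_at by blast
  qed
  then show ?case by (simp add: continuous_at_imp_continuous_on)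
next
  case (Suc n)
  have der: "(f has_derivative frechet_derivative h (at x)) (at x)"
    if "open T" "x \<in> T" "Ck_on (Suc n) T h" "\<forall>y\<in>T. f y = h y" for T h x
  proof -
    have "(h has_derivative frechet_derivative h (at x)) (at x)"
      using that frechet_derivative_works unfolding Ck_on.simps by blast
    then show ?thesis
      using that(1,2) by (rule has_derivative_transform_within_open) (simp add: that(4))
  qed
  show ?case
    unfolding Ck_on.simps
  proof (intro conjI ballI allI)
    fix x assume "x \<in> S"
    then obtain T h where "open T" "x \<in> T" "Ck_on (Suc n) T h" "\<forall>y\<in>T. f y = h y"
      using Suc.prems by blast
    then show "f differentiable at x" by (intro differentiableI[OF der])
  next
    fix v
    show "Ck_on n S (\<lambda>x. frechet_derivative f (at x) v)"
    proof (rule Suc.IH)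
      fix x assume "x \<in> S"
      then obtain T h where T: "open T" "x \<in> T" "Ck_on (Suc n) T h" "\<forall>y\<in>T. f y = h y"
        using Suc.prems by blast
      have "\<forall>y\<in>T. frechet_derivative f (at y) v = frechet_derivative h (at y) v"
        using frechet_derivative_at[OF der[OF T(1) _ T(3,4)]] by simp
      then show "\<exists>T h. open T \<and> x \<in> T \<and> Ck_on n T h \<and>
          (\<forall>y\<in>T. frechet_derivative f (at y) v = h y)"
        using T(1,2,3) unfolding Ck_on.simps by blast
    qed
  qed
qed

lemma heis_mult_affine:
  "\<exists>L. bounded_linear L \<and> (\<lambda>z. heis_mult z c) = (\<lambda>z. L z + c)"
proof -
  obtain a b e where c: "c = (a, b, e)" by (cases c)
  have "bounded_linear (\<lambda>z::complex \<times> complex \<times> complex. (fst z, fst z * e + fst (snd z), snd (snd z)))"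
    by (intro bounded_linear_intros)
  moreover have "(\<lambda>z. heis_mult z c) = (\<lambda>z. (fst z, fst z * e + fst (snd z), snd (snd z)) + c)"
    by (auto simp: c fun_eq_iff)
  ultimately show ?thesis by blast
qed

lemma smooth_atlas_iwasawa: "smooth_atlas iwasawa_atlas"
proof -
  let ?p = iwasawa_proj
  have surj: "\<exists>z. x = ?p z" for x
    by (cases x) (auto simp: iwasawa_proj_def heis_group_def)
  have inv: "inv_into V ?p (?p z) = z" if "inj_on ?p V" "z \<in> V" for V z
    using that by simp
  have cover: "(\<Union>c\<in>iwasawa_atlas. fst c) = UNIV"
  proof -
    have "x \<in> (\<Union>c\<in>iwasawa_atlas. fst c)" for x
    proof -
      obtain z where "x = ?p z" using surj by blast
      then show ?thesis
        using inj_on_iwasawa_proj_ball[of z] unfolding iwasawa_atlas_def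
        by (intro UN_I[of "(?p ` ball z (1/2), inv_into (ball z (1/2)) ?p)"]) auto
    qed
    then show ?thesis by blast
  qed
  have im: "inv_into V ?p ` (?p ` V) = V" if "inj_on ?p V" for V
    using that by simp
  have cinv: "chart_inv (?p ` V, inv_into V ?p) z = ?p z" if "inj_on ?p V" "z \<in> V" for V z
    unfolding chart_inv_def fst_conv snd_conv
    using that by (intro inv_into_f_eq inj_on_inv_into) auto
  have loc: "\<exists>T c. open T \<and> z \<in> T \<and> T \<subseteq> V \<and> (\<forall>y\<in>T. heis_mult y c \<in> W \<and> ?p (heis_mult y c) = ?p y)"
    if V: "open V" "open W" "z \<in> V" "?p z \<in> ?p ` W" for V W z
  proof -
    obtain c where c: "c \<in> gauss_int \<times> gauss_int \<times> gauss_int" "heis_mult z c \<in> W"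
      using V(4) iwasawa_proj_eq_iff by (metis imageE)
    obtain L where L: "bounded_linear L" "(\<lambda>z. heis_mult z c) = (\<lambda>z. L z + c)"
      using heis_mult_affine by blast
    have "continuous_on UNIV (\<lambda>z. heis_mult z c)"
      unfolding L(2) by (intro continuous_intros linear_continuous_on L(1))
    then have "open ((\<lambda>z. heis_mult z c) -` W)" using V(2) by (simp add: open_vimage)
    moreover have "\<forall>y. ?p (heis_mult y c) = ?p y"
      using iwasawa_proj_eq_iff c(1) by metis
    ultimately show ?thesis
      using V c by (intro exI[of _ "V \<inter> (\<lambda>z. heis_mult z c) -` W"] exI[of _ c]) auto
  qed
  have "open (inv_into V ?p ` (?p ` V \<inter> ?p ` W)) \<and>
      smooth_on (inv_into V ?p ` (?p ` V \<inter> ?p ` W))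
        (inv_into W ?p \<circ> chart_inv (?p ` V, inv_into V ?p))"
    if V: "open V" "inj_on ?p V" "open W" "inj_on ?p W" for V W
  proof
    have S: "inv_into V ?p ` (?p ` V \<inter> ?p ` W) = {z \<in> V. ?p z \<in> ?p ` W}" (is "?S = _")
    proof
      show "?S \<subseteq> {z \<in> V. ?p z \<in> ?p ` W}" using inv[OF V(2)] by (smt (verit) IntE imageE image_eqI mem_Collect_eq subsetI)
      show "{z \<in> V. ?p z \<in> ?p ` W} \<subseteq> ?S" using inv[OF V(2)] by (smt (verit) IntI image_eqI mem_Collect_eq subsetI)
    qed
    have "\<exists>T. open T \<and> z \<in> T \<and> T \<subseteq> ?S" if "z \<in> ?S" for z
    proof -
      from that have "z \<in> V" "?p z \<in> ?p ` W" unfolding S by auto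
      then obtain T c where "open T" "z \<in> T" "T \<subseteq> V"
          "\<forall>y\<in>T. heis_mult y c \<in> W \<and> ?p (heis_mult y c) = ?p y"
        using loc[OF V(1) V(3)] by metis
      then show ?thesis unfolding S by (intro exI[of _ T]) (auto, metis image_eqI)
    qed
    then show "open ?S" by (meson openI open_subopen)
    show "smooth_on ?S (inv_into W ?p \<circ> chart_inv (?p ` V, inv_into V ?p))"
      unfolding smooth_on_def
    proof (intro allI Ck_on_local)
      fix n z assume "z \<in> ?S"
      then have "z \<in> V" "?p z \<in> ?p ` W" unfolding S by auto
      then obtain T c where T: "open T" "z \<in> T" "T \<subseteq> V"
          "\<forall>y\<in>T. heis_mult y c \<in> W \<and> ?p (heis_mult y c) = ?p y"
        using loc[OF V(1) V(3)] by metis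
      obtain L where L: "bounded_linear L" "(\<lambda>z. heis_mult z c) = (\<lambda>z. L z + c)"
        using heis_mult_affine by blast
      have "Ck_on n T (\<lambda>z. heis_mult z c)"
        unfolding L(2) by (rule Ck_on_affine[OF L(1)])
      moreover have "(inv_into W ?p \<circ> chart_inv (?p ` V, inv_into V ?p)) y = heis_mult y c"
        if "y \<in> T" for y
      proof -
        have "y \<in> V" using that T(3) by blast
        then have "(inv_into W ?p \<circ> chart_inv (?p ` V, inv_into V ?p)) y = inv_into W ?p (?p y)"
          using cinv[OF V(2)] by simp
        also have "\<dots> = inv_into W ?p (?p (heis_mult y c))" using T(4) that by simp
        also have "\<dots> = heis_mult y c" using inv[OF V(4)] T(4) that by blast
        finally show ?thesis .
      qed
      ultimately show "\<exists>T h. open T \<and> z \<in> T \<and> Ck_on n T h \<and>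
          (\<forall>y\<in>T. (inv_into W ?p \<circ> chart_inv (?p ` V, inv_into V ?p)) y = h y)"
        using T by blast
    qed
  qed
  note trans = this
  have chart: "inj_on (inv_into V ?p) (?p ` V) \<and> open (inv_into V ?p ` ?p ` V)"
    if "open V" "inj_on ?p V" for V
    using that im[OF that(2)] by (simp add: inj_on_inv_into)
  show ?thesis
    unfolding smooth_atlas_def
  proof (intro conjI cover ballI)
    fix c assume "c \<in> iwasawa_atlas"
    then obtain V where V: "open V" "inj_on ?p V" "c = (?p ` V, inv_into V ?p)"
      unfolding iwasawa_atlas_def by blast
    show "inj_on (snd c) (fst c)" "open (snd c ` fst c)"
      using chart[OF V(1,2)] by (simp_all add: V(3))
    fix d assume "d \<in> iwasawa_atlas"
    then obtain W where W: "open W" "inj_on ?p W" "d = (?p ` W, inv_into W ?p)"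
      unfolding iwasawa_atlas_def by blast
    show "open (snd c ` (fst c \<inter> fst d))"
      "smooth_on (snd c ` (fst c \<inter> fst d)) (snd d \<circ> chart_inv c)"
      using trans[OF V(1,2) W(1,2)] by (simp_all add: V(3) W(3))
  qed
qed

end

theory Submission
  imports Defs
begin

text \<open>
  The right-invariant forms \<open>dz1\<close>, \<open>dz2 - z3 dz1\<close>, \<open>dz3\<close> of the Heisenberg group descend to
  \<open>G/\<Gamma>\<close> and trivialise its tangent bundle; in this trivialisation vector fields are smooth
  maps into \<open>\<complex>\<^sup>3\<close>, and the bracket is the derivative part plus a constant bilinear map \<open>lie\<close>. Take
  the standard metric and let \<open>J\<close> be \<open>(i, -i, i)\<close>: conjugating the central direction makes
  \<open>lie\<close>, and hence also the constant part of the Levi-Civita connection, \<open>J\<close>-antilinear in both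
  arguments. Therefore \<open>[T\<^sup>1\<^sup>0, T\<^sup>0\<^sup>1] = 0\<close> on the frame, so the connection for which the frame is
  parallel is the canonical one, and it is flat; \<open>d\<omega>\<close> has type \<open>(3,0) + (0,3)\<close>; and each of
  the three terms of the constant expression for \<open>R\<close> vanishes on the types in question.
\<close>

section \<open>Calculus of smooth maps\<close>

lemma Ck_on_subset: "Ck_on n S f \<Longrightarrow> T \<subseteq> S \<Longrightarrow> Ck_on n T f"
  by (induction n arbitrary: f) (auto intro: continuous_on_subset)

lemma Ck_on_Suc_imp: "Ck_on (Suc n) S f \<Longrightarrow> Ck_on n S f"
proof (induction n arbitrary: f)
  case 0
  then show ?case
    by (auto intro!: continuous_at_imp_continuous_on differentiable_imp_continuous_within)
next
  case (Suc n)
  then show ?case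
    unfolding Ck_on.simps(2)[of "Suc n"] Ck_on.simps(2)[of n] by blast
qed

lemma Ck_on_cong:
  assumes "open S" "Ck_on n S g" "\<And>x. x \<in> S \<Longrightarrow> f x = g x"
  shows "Ck_on n S f"
  using assms by (intro Ck_on_local exI[of _ S] exI[of _ g]) simp

lemma Ck_on_has_derivative:
  assumes "Ck_on (Suc n) S f" "x \<in> S"
  shows "(f has_derivative frechet_derivative f (at x)) (at x)"
  using assms by (simp flip: frechet_derivative_works)

text \<open>\<open>frechet_derivative\<close> is a chosen object; uniqueness of derivatives
  identifies it on \<open>S\<close> with any explicit \<open>f'\<close>, so inductions on the order
  can work with derivative formulas.\<close>

lemma Ck_on_SucI:
  assumes "open S" "\<And>x. x \<in> S \<Longrightarrow> (f has_derivative f' x) (at x)" "\<And>v. Ck_on n S (\<lambda>x. f' x v)"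
  shows "Ck_on (Suc n) S f"
  unfolding Ck_on.simps
proof (intro conjI ballI allI)
  show "f differentiable (at x)" if "x \<in> S" for x
    by (rule differentiableI[OF assms(2)[OF that]])
  show "Ck_on n S (\<lambda>x. frechet_derivative f (at x) v)" for v
    by (rule Ck_on_cong[OF assms(1,3)]) (simp add: frechet_derivative_at[OF assms(2), symmetric])
qed

lemma Ck_on_bounded_linear:
  assumes "open S" "bounded_linear L"
  shows "Ck_on n S f \<Longrightarrow> Ck_on n S (\<lambda>x. L (f x))"
proof (induction n arbitrary: f)
  case 0
  then show ?case by (simp add: bounded_linear.continuous_on[OF assms(2)])
next
  case (Suc n)
  have der: "((\<lambda>x. L (f x)) has_derivative (\<lambda>v. L (frechet_derivative f (at x) v))) (at x)"
    if "x \<in> S" for x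
    by (rule bounded_linear.has_derivative[OF assms(2) Ck_on_has_derivative[OF Suc.prems that]])
  have "Ck_on n S (\<lambda>x. L (frechet_derivative f (at x) v))" for v
    using Suc.prems by (intro Suc.IH) auto
  then show ?case
    by (rule Ck_on_SucI[OF assms(1), rotated]) (rule der)
qed

lemma Ck_on_add:
  assumes "open S"
  shows "Ck_on n S f \<Longrightarrow> Ck_on n S g \<Longrightarrow> Ck_on n S (\<lambda>x. f x + g x)"
proof (induction n arbitrary: f g)
  case 0
  then show ?case by (simp add: continuous_on_add)
next
  case (Suc n)
  have der: "((\<lambda>x. f x + g x) has_derivative
      (\<lambda>v. frechet_derivative f (at x) v + frechet_derivative g (at x) v)) (at x)" if "x \<in> S" for x
    by (intro has_derivative_add Ck_on_has_derivative[OF Suc.prems(1) that]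
        Ck_on_has_derivative[OF Suc.prems(2) that])
  have "Ck_on n S (\<lambda>x. frechet_derivative f (at x) v + frechet_derivative g (at x) v)" for v
    using Suc.prems by (intro Suc.IH) auto
  then show ?case
    by (rule Ck_on_SucI[OF assms(1), rotated]) (rule der)
qed

lemma Ck_on_bounded_bilinear:
  assumes "open S" "bounded_bilinear B"
  shows "Ck_on n S f \<Longrightarrow> Ck_on n S g \<Longrightarrow> Ck_on n S (\<lambda>x. B (f x) (g x))"
proof (induction n arbitrary: f g)
  case 0
  then show ?case by (simp add: bounded_bilinear.continuous_on[OF assms(2)])
next
  case (Suc n)
  have der: "((\<lambda>x. B (f x) (g x)) has_derivative
      (\<lambda>v. B (f x) (frechet_derivative g (at x) v) + B (frechet_derivative f (at x) v) (g x))) (at x)"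
    if "x \<in> S" for x
    by (rule bounded_bilinear.FDERIV[OF assms(2)])
      (rule Ck_on_has_derivative[OF Suc.prems(1) that] Ck_on_has_derivative[OF Suc.prems(2) that])+
  \<comment> \<open>The product rule leaves one factor undifferentiated in each summand; its order
    is lowered from \<open>Suc n\<close> to \<open>n\<close> before the induction hypothesis
    applies.\<close>
  have "Ck_on n S (\<lambda>x. B (f x) (frechet_derivative g (at x) v) +
      B (frechet_derivative f (at x) v) (g x))" for v
    using Suc.prems Suc.prems[THEN Ck_on_Suc_imp]
    by (intro Ck_on_add[OF assms(1)] Suc.IH) auto
  then show ?case
    by (rule Ck_on_SucI[OF assms(1), rotated]) (rule der)
qed

section \<open>Smooth maps and derivatives in varying directions\<close>

lemma smooth_on_subset: "smooth_on S f \<Longrightarrow> T \<subseteq> S \<Longrightarrow> smooth_on T f"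
  by (auto simp: smooth_on_def intro: Ck_on_subset)

lemma smooth_on_cong:
  "open S \<Longrightarrow> smooth_on S g \<Longrightarrow> (\<And>x. x \<in> S \<Longrightarrow> f x = g x) \<Longrightarrow> smooth_on S f"
  by (auto simp: smooth_on_def intro: Ck_on_cong)

lemma smooth_on_const: "smooth_on S (\<lambda>x. k)"
  by (simp add: smooth_on_def Ck_on_const)

lemma smooth_on_id: "smooth_on S (\<lambda>x. x)"
  using Ck_on_affine[OF bounded_linear_ident, of _ S 0] by (simp add: smooth_on_def)

lemma smooth_on_bounded_linear:
  "open S \<Longrightarrow> bounded_linear L \<Longrightarrow> smooth_on S f \<Longrightarrow> smooth_on S (\<lambda>x. L (f x))"
  by (simp add: smooth_on_def Ck_on_bounded_linear)

lemma smooth_on_add: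
  "open S \<Longrightarrow> smooth_on S f \<Longrightarrow> smooth_on S g \<Longrightarrow> smooth_on S (\<lambda>x. f x + g x)"
  by (simp add: smooth_on_def Ck_on_add)

lemma smooth_on_bounded_bilinear:
  "open S \<Longrightarrow> bounded_bilinear B \<Longrightarrow> smooth_on S f \<Longrightarrow> smooth_on S g \<Longrightarrow>
    smooth_on S (\<lambda>x. B (f x) (g x))"
  by (simp add: smooth_on_def Ck_on_bounded_bilinear)

lemma smooth_on_sum:
  assumes "open S" "\<And>i. i \<in> I \<Longrightarrow> smooth_on S (f i)"
  shows "smooth_on S (\<lambda>x. \<Sum>i\<in>I. f i x)"
  using assms(2)
  by (induction I rule: infinite_finite_induct) (auto simp: smooth_on_const intro!: smooth_on_add assms(1))

lemma smooth_on_has_derivative: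
  "smooth_on S f \<Longrightarrow> x \<in> S \<Longrightarrow> (f has_derivative frechet_derivative f (at x)) (at x)"
  unfolding smooth_on_def by (metis Ck_on_has_derivative)

lemma smooth_on_frechet_derivative_const:
  "smooth_on S f \<Longrightarrow> smooth_on S (\<lambda>x. frechet_derivative f (at x) v)"
  unfolding smooth_on_def by (metis Ck_on.simps(2))

text \<open>\<open>Ck_on\<close> speaks of constant directions only. Expanding over the basis
  reduces a direction that varies with the point to finitely many constant ones with varying
  coefficients.\<close>

lemma frechet_derivative_basis:
  assumes "(f has_derivative frechet_derivative f (at x)) (at (x::'a::euclidean_space))"
  shows "frechet_derivative f (at x) v = (\<Sum>b\<in>Basis. (v \<bullet> b) *\<^sub>R frechet_derivative f (at x) b)"
proof -
  interpret D: linear "frechet_derivative f (at x)"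
    using assms by (rule has_derivative_linear)
  have "frechet_derivative f (at x) v = frechet_derivative f (at x) (\<Sum>b\<in>Basis. (v \<bullet> b) *\<^sub>R b)"
    by (simp add: euclidean_representation)
  then show ?thesis by (simp only: D.sum D.scale)
qed

lemma smooth_on_frechet_derivative:
  assumes "open S" "smooth_on S f" "smooth_on S h"
  shows "smooth_on S (\<lambda>x. frechet_derivative f (at x) (h x))"
proof (rule smooth_on_cong[OF assms(1)])
  show "smooth_on S (\<lambda>x. \<Sum>b\<in>Basis. (h x \<bullet> b) *\<^sub>R frechet_derivative f (at x) b)"
    by (intro smooth_on_sum[OF assms(1)] smooth_on_bounded_bilinear[OF assms(1) bounded_bilinear_scaleR]
      smooth_on_bounded_linear[OF assms(1) bounded_linear_inner_left assms(3)]
      smooth_on_frechet_derivative_const[OF assms(2)])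
  show "frechet_derivative f (at x) (h x) =
      (\<Sum>b\<in>Basis. (h x \<bullet> b) *\<^sub>R frechet_derivative f (at x) b)" if "x \<in> S" for x
    by (rule frechet_derivative_basis[OF smooth_on_has_derivative[OF assms(2) that]])
qed

text \<open>The product rule for a derivative in a varying direction: one summand freezes the
  direction at \<open>h x\<close>, the other differentiates it. It serves to differentiate a field
  applied to a function once more.\<close>

lemma has_derivative_frechet_derivative:
  assumes "smooth_on UNIV f" "(h has_derivative h') (at x)"
  shows "((\<lambda>y. frechet_derivative f (at y) (h y)) has_derivative
    (\<lambda>v. frechet_derivative (\<lambda>y. frechet_derivative f (at y) (h x)) (at x) v
       + frechet_derivative f (at x) (h' v))) (at x)"
proof -
  let ?D = "\<lambda>y. frechet_derivative f (at y)"
  have b: "?D y v = (\<Sum>b\<in>Basis. (v \<bullet> b) *\<^sub>R ?D y b)" for y v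
    by (rule frechet_derivative_basis[OF smooth_on_has_derivative[OF assms(1) UNIV_I]])
  have d: "((\<lambda>y. ?D y b) has_derivative frechet_derivative (\<lambda>y. ?D y b) (at x)) (at x)" for b
    by (rule smooth_on_has_derivative[OF smooth_on_frechet_derivative_const[OF assms(1)] UNIV_I])
  have "((\<lambda>y. \<Sum>b\<in>Basis. (h x \<bullet> b) *\<^sub>R ?D y b) has_derivative
      (\<lambda>v. \<Sum>b\<in>Basis. (h x \<bullet> b) *\<^sub>R frechet_derivative (\<lambda>y. ?D y b) (at x) v)) (at x)"
    by (intro has_derivative_sum bounded_linear.has_derivative[OF bounded_linear_scaleR_right] d)
  then have e: "frechet_derivative (\<lambda>y. ?D y (h x)) (at x) =
      (\<lambda>v. \<Sum>b\<in>Basis. (h x \<bullet> b) *\<^sub>R frechet_derivative (\<lambda>y. ?D y b) (at x) v)"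
    unfolding b[of _ "h x"] by (rule frechet_derivative_at[symmetric])
  have "((\<lambda>y. \<Sum>b\<in>Basis. (h y \<bullet> b) *\<^sub>R ?D y b) has_derivative
      (\<lambda>v. \<Sum>b\<in>Basis. (h x \<bullet> b) *\<^sub>R frechet_derivative (\<lambda>y. ?D y b) (at x) v
        + (h' v \<bullet> b) *\<^sub>R ?D x b)) (at x)"
    by (intro has_derivative_sum bounded_bilinear.FDERIV[OF bounded_bilinear_scaleR] d
      bounded_linear.has_derivative[OF bounded_linear_inner_left] assms(2))
  moreover have "(\<lambda>y. ?D y (h y)) = (\<lambda>y. \<Sum>b\<in>Basis. (h y \<bullet> b) *\<^sub>R ?D y b)"
    by (rule ext) (rule b)
  moreover have "frechet_derivative (\<lambda>y. ?D y (h x)) (at x) v + ?D x (h' v) =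
      (\<Sum>b\<in>Basis. (h x \<bullet> b) *\<^sub>R frechet_derivative (\<lambda>y. ?D y b) (at x) v
        + (h' v \<bullet> b) *\<^sub>R ?D x b)" for v
    unfolding e b[of x "h' v"] sum.distrib ..
  ultimately show ?thesis by simp
qed

section \<open>Symmetry of the second derivative\<close>

lemma has_real_derivative_along_line:
  fixes f :: "'a::real_normed_vector \<Rightarrow> real"
  assumes "\<And>y. (f has_derivative f' y) (at y)"
  shows "((\<lambda>t. f (x + t *\<^sub>R v)) has_real_derivative f' (x + t *\<^sub>R v) v) (at t)"
proof -
  have "((\<lambda>t. x + t *\<^sub>R v) has_derivative (\<lambda>s. s *\<^sub>R v)) (at t)"
    by (auto intro!: derivative_eq_intros)
  then have "(f \<circ> (\<lambda>t. x + t *\<^sub>R v) has_derivative f' (x + t *\<^sub>R v) \<circ> (\<lambda>s. s *\<^sub>R v)) (at t)"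
    by (rule diff_chain_at) (rule assms)
  then show ?thesis
    unfolding has_field_derivative_def comp_def
    by (rule has_derivative_eq_rhs)
      (auto simp: linear_cmul[OF has_derivative_linear[OF assms]])
qed

text \<open>
  The left-hand side is symmetric in \<open>v\<close> and \<open>w\<close>, so letting \<open>h\<close> tend to \<open>0\<close> gives the
  symmetry of the second derivative.
\<close>

lemma second_difference_mean_value:
  fixes f :: "'a::euclidean_space \<Rightarrow> real"
  assumes f: "smooth_on UNIV f" and h: "0 < h"
  shows "\<exists>y. norm (y - x) \<le> h * (norm v + norm w) \<and>
    f (x + h *\<^sub>R v + h *\<^sub>R w) - f (x + h *\<^sub>R v) - f (x + h *\<^sub>R w) + f x =
    h * h * frechet_derivative (\<lambda>y. frechet_derivative f (at y) v) (at y) w"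
proof -
  let ?D = "\<lambda>y. frechet_derivative f (at y)"
  let ?DD = "\<lambda>y. frechet_derivative (\<lambda>y. ?D y v) (at y)"
  have d: "(f has_derivative ?D y) (at y)" for y
    by (rule smooth_on_has_derivative[OF f UNIV_I])
  have dd: "((\<lambda>y. ?D y v) has_derivative ?DD y) (at y)" for y
    by (rule smooth_on_has_derivative[OF smooth_on_frechet_derivative_const[OF f] UNIV_I])
  \<comment> \<open>First mean value theorem: the increment of \<open>f\<close> in direction
    \<open>w\<close>, regarded as a function of the displacement along \<open>v\<close>.\<close>
  have "((\<lambda>s. f (x + h *\<^sub>R w + s *\<^sub>R v) - f (x + s *\<^sub>R v)) has_real_derivative
      ?D (x + h *\<^sub>R w + s *\<^sub>R v) v - ?D (x + s *\<^sub>R v) v) (at s)" for s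
    by (intro DERIV_diff has_real_derivative_along_line d)
  then obtain s where s: "0 < s" "s < h"
    "f (x + h *\<^sub>R w + h *\<^sub>R v) - f (x + h *\<^sub>R v) - (f (x + h *\<^sub>R w) - f x) =
      h * (?D (x + h *\<^sub>R w + s *\<^sub>R v) v - ?D (x + s *\<^sub>R v) v)"
    using MVT2[OF h, of "\<lambda>s. f (x + h *\<^sub>R w + s *\<^sub>R v) - f (x + s *\<^sub>R v)"
        "\<lambda>s. ?D (x + h *\<^sub>R w + s *\<^sub>R v) v - ?D (x + s *\<^sub>R v) v"] by auto
  \<comment> \<open>Second mean value theorem: the derivative along \<open>v\<close> just obtained,
    regarded as a function of the displacement along \<open>w\<close>.\<close>
  have "((\<lambda>t. ?D (x + s *\<^sub>R v + t *\<^sub>R w) v) has_real_derivative ?DD (x + s *\<^sub>R v + t *\<^sub>R w) w) (at t)" for t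
    by (rule has_real_derivative_along_line[OF dd])
  then obtain t where t: "0 < t" "t < h"
    "?D (x + s *\<^sub>R v + h *\<^sub>R w) v - ?D (x + s *\<^sub>R v) v = h * ?DD (x + s *\<^sub>R v + t *\<^sub>R w) w"
    using MVT2[OF h, of "\<lambda>t. ?D (x + s *\<^sub>R v + t *\<^sub>R w) v"
        "\<lambda>t. ?DD (x + s *\<^sub>R v + t *\<^sub>R w) w"] by auto
  have "norm (s *\<^sub>R v + t *\<^sub>R w) \<le> s * norm v + t * norm w"
    using norm_triangle_ineq[of "s *\<^sub>R v" "t *\<^sub>R w"] s t by simp
  also have "\<dots> \<le> h * (norm v + norm w)"
    unfolding distrib_left using s t by (intro add_mono mult_right_mono) auto
  finally show ?thesis
    using s(3) t(3) by (intro exI[of _ "x + s *\<^sub>R v + t *\<^sub>R w"]) (simp add: algebra_simps)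
qed

lemma symmetric_second_derivative_real:
  fixes f :: "'a::euclidean_space \<Rightarrow> real"
  assumes f: "smooth_on UNIV f"
  shows "frechet_derivative (\<lambda>y. frechet_derivative f (at y) v) (at x) w =
    frechet_derivative (\<lambda>y. frechet_derivative f (at y) w) (at x) v"
proof -
  let ?DD = "\<lambda>v w y. frechet_derivative (\<lambda>y. frechet_derivative f (at y) v) (at y) w"
  \<comment> \<open>Second derivatives are themselves differentiable, hence continuous; this allows
    the passage to the limit.\<close>
  have "isCont (?DD v w) x" for v w
    using smooth_on_has_derivative[OF smooth_on_frechet_derivative_const[OF
        smooth_on_frechet_derivative_const[OF f]] UNIV_I]
    by (rule has_derivative_continuous)
  then have lim: "(\<lambda>n. ?DD v w (X n)) \<longlonglongrightarrow> ?DD v w x" if "X \<longlonglongrightarrow> x" for X v w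
    using that by (rule isCont_tendsto_compose)
  define h where "h n = inverse (real (Suc n))" for n
  have h: "0 < h n" "h \<longlonglongrightarrow> 0" for n
    unfolding h_def by (simp, rule LIMSEQ_inverse_real_of_nat)
  \<comment> \<open>The intermediate points are within \<open>h n * (norm v + norm w)\<close> of
    \<open>x\<close>, so they converge to \<open>x\<close>.\<close>
  have ex: "\<exists>Y. Y \<longlonglongrightarrow> x \<and> (\<forall>n. f (x + h n *\<^sub>R v + h n *\<^sub>R w) - f (x + h n *\<^sub>R v) - f (x + h n *\<^sub>R w) + f x =
      h n * h n * ?DD v w (Y n))" for v w
  proof -
    have "\<forall>n. \<exists>y. norm (y - x) \<le> h n * (norm v + norm w) \<and>
        f (x + h n *\<^sub>R v + h n *\<^sub>R w) - f (x + h n *\<^sub>R v) - f (x + h n *\<^sub>R w) + f x =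
        h n * h n * ?DD v w y"
      by (intro allI second_difference_mean_value[OF f h(1)])
    then obtain Y where Y: "\<forall>n. norm (Y n - x) \<le> h n * (norm v + norm w) \<and>
        f (x + h n *\<^sub>R v + h n *\<^sub>R w) - f (x + h n *\<^sub>R v) - f (x + h n *\<^sub>R w) + f x =
        h n * h n * ?DD v w (Y n)"
      by (rule choice[THEN exE])
    have "(\<lambda>n. h n * (norm v + norm w)) \<longlonglongrightarrow> 0"
      using h(2) by (rule tendsto_mult_left_zero)
    then have "(\<lambda>n. Y n - x) \<longlonglongrightarrow> 0"
      by (rule Lim_null_comparison[rotated]) (simp add: Y)
    then show ?thesis using Y LIM_zero_cancel by blast
  qed
  obtain Y1 Y2 where Y: "Y1 \<longlonglongrightarrow> x" "Y2 \<longlonglongrightarrow> x"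
    "\<And>n. f (x + h n *\<^sub>R v + h n *\<^sub>R w) - f (x + h n *\<^sub>R v) - f (x + h n *\<^sub>R w) + f x =
      h n * h n * ?DD v w (Y1 n)"
    "\<And>n. f (x + h n *\<^sub>R w + h n *\<^sub>R v) - f (x + h n *\<^sub>R w) - f (x + h n *\<^sub>R v) + f x =
      h n * h n * ?DD w v (Y2 n)"
    using ex[of v w] ex[of w v] by blast
  have "?DD v w (Y1 n) = ?DD w v (Y2 n)" for n
  proof -
    have "h n * h n * ?DD v w (Y1 n) = h n * h n * ?DD w v (Y2 n)"
      unfolding Y(3,4)[symmetric] by (simp add: algebra_simps)
    then show ?thesis using h(1)[of n] by simp
  qed
  then show ?thesis
    using lim[OF Y(1), of v w] lim[OF Y(2), of w v] by (simp add: LIMSEQ_unique)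
qed

text \<open>Inner products with basis vectors commute with differentiation, which reduces the claim
  to the real case.\<close>

lemma symmetric_second_derivative:
  fixes f :: "'a::euclidean_space \<Rightarrow> 'b::euclidean_space"
  assumes f: "smooth_on UNIV f"
  shows "frechet_derivative (\<lambda>y. frechet_derivative f (at y) v) (at x) w =
    frechet_derivative (\<lambda>y. frechet_derivative f (at y) w) (at x) v"
proof (rule euclidean_eqI)
  fix b :: 'b
  have comp: "frechet_derivative (\<lambda>y. g y \<bullet> b) (at y) = (\<lambda>v. frechet_derivative g (at y) v \<bullet> b)"
    if "smooth_on UNIV g" for g :: "'a \<Rightarrow> 'b" and y
    using bounded_linear.has_derivative[OF bounded_linear_inner_left
        smooth_on_has_derivative[OF that UNIV_I]]
    by (rule frechet_derivative_at[symmetric])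
  have "frechet_derivative (\<lambda>y. frechet_derivative f (at y) v) (at x) w \<bullet> b =
      frechet_derivative (\<lambda>y. frechet_derivative (\<lambda>y. f y \<bullet> b) (at y) v) (at x) w" for v w
    by (simp add: comp f smooth_on_frechet_derivative_const)
  then show "frechet_derivative (\<lambda>y. frechet_derivative f (at y) v) (at x) w \<bullet> b =
      frechet_derivative (\<lambda>y. frechet_derivative f (at y) w) (at x) v \<bullet> b"
    using symmetric_second_derivative_real[OF smooth_on_bounded_linear[OF open_UNIV
        bounded_linear_inner_left f]] by simp
qed

lemma smooth_on_local:
  assumes "\<And>x. x \<in> S \<Longrightarrow> \<exists>T. open T \<and> x \<in> T \<and> smooth_on T f"
  shows "smooth_on S f"
  unfolding smooth_on_def
proof (intro allI Ck_on_local)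
  fix n x assume "x \<in> S"
  then obtain T where "open T" "x \<in> T" "smooth_on T f" using assms by blast
  then show "\<exists>T h. open T \<and> x \<in> T \<and> Ck_on n T h \<and> (\<forall>y\<in>T. f y = h y)"
    by (intro exI[of _ T] exI[of _ f]) (simp add: smooth_on_def)
qed

text \<open>Both sides are choices from the same set of derivatives, so no differentiability is
  assumed.\<close>

lemma frechet_derivative_cong_open:
  assumes "open S" "x \<in> S" "\<And>y. y \<in> S \<Longrightarrow> f y = g y"
  shows "frechet_derivative f (at x) = frechet_derivative g (at x)"
proof -
  have "(f has_derivative D) (at x) \<longleftrightarrow> (g has_derivative D) (at x)" for D
    using assms has_derivative_transform_within_open[of f D x UNIV S g]
      has_derivative_transform_within_open[of g D x UNIV S f] by auto
  then show ?thesis by (simp add: frechet_derivative_def)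
qed

section \<open>The right-invariant frame\<close>

type_synonym complex3 = "complex \<times> complex \<times> complex"

text \<open>A right-invariant field is \<open>N * heis z\<close> with \<open>N\<close> strictly
  upper triangular; this is the part of the product that depends on \<open>z\<close>. Its
  bilinearity supplies smoothness and the product rule.\<close>

definition shear :: "complex3 \<Rightarrow> complex3 \<Rightarrow> complex3" where
  "shear z v = (0, snd (snd z) * fst v, 0)"

text \<open>
  \<open>frame z v\<close> is the value at \<open>z\<close> of the right-invariant vector field that is \<open>v\<close> at the identity.
\<close>

definition frame :: "complex3 \<Rightarrow> complex3 \<Rightarrow> complex3" where
  "frame z v = v + shear z v"

text \<open>The three right-invariant forms at \<open>z\<close>, evaluated on \<open>v\<close>. It
  inverts \<open>frame z\<close> because \<open>shear z\<close> squares to zero.\<close>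

definition coframe :: "complex3 \<Rightarrow> complex3 \<Rightarrow> complex3" where
  "coframe z v = v - shear z v"

lemma bounded_bilinear_shear: "bounded_bilinear shear"
  unfolding bilinear_conv_bounded_bilinear[symmetric] bilinear_def shear_def
  by (auto intro!: linearI simp: algebra_simps)

lemma bounded_linear_frame: "bounded_linear (frame z)"
  unfolding frame_def
  by (intro bounded_linear_add bounded_linear_ident
      bounded_bilinear.bounded_linear_right[OF bounded_bilinear_shear])

lemma bounded_linear_coframe: "bounded_linear (coframe z)"
  unfolding coframe_def
  by (intro bounded_linear_sub bounded_linear_ident
      bounded_bilinear.bounded_linear_right[OF bounded_bilinear_shear])

lemma coframe_frame [simp]: "coframe z (frame z v) = v"
  and frame_coframe [simp]: "frame z (coframe z v) = v"
  by (simp_all add: frame_def coframe_def shear_def prod_eq_iff)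

lemmas frame_linear = bounded_linear.linear[OF bounded_linear_frame]
lemmas coframe_linear = bounded_linear.linear[OF bounded_linear_coframe]

text \<open>Right invariance of the frame: a right translation preserves components. The lattice
  acts by such translations, which is why the frame descends to the quotient.\<close>

lemma heis_mult_has_derivative:
  "((\<lambda>u. heis_mult u c) has_derivative (\<lambda>v. frame (heis_mult z c) (coframe z v))) (at z)"
proof -
  have "(\<lambda>u. heis_mult u c) = (\<lambda>u. (fst u + fst c, fst (snd c) + fst u * snd (snd c) + fst (snd u), snd (snd u) + snd (snd c)))"
    by (cases c) (auto simp: fun_eq_iff)
  moreover have "(\<lambda>v. frame (heis_mult z c) (coframe z v)) =
      (\<lambda>v. (fst v, fst v * snd (snd c) + fst (snd v), snd (snd v)))"
    by (cases z; cases c) (auto simp: fun_eq_iff frame_def coframe_def shear_def algebra_simps)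
  moreover have "((\<lambda>u. (fst u + fst c, fst (snd c) + fst u * snd (snd c) + fst (snd u), snd (snd u) + snd (snd c)))
      has_derivative (\<lambda>v. (fst v + 0, 0 + fst v * snd (snd c) + fst (snd v), snd (snd v) + 0))) (at z)"
    by (intro has_derivative_Pair has_derivative_add has_derivative_const has_derivative_fst
        has_derivative_snd has_derivative_mult_left has_derivative_ident)
  ultimately show ?thesis by simp
qed

section \<open>Charts as local sections of the quotient map\<close>

lemma iwasawa_proj_surj: obtains z where "x = iwasawa_proj z"
  by (cases x) (auto simp: iwasawa_proj_def heis_group_def)

lemma iwasawa_chart:
  assumes "c \<in> iwasawa_atlas"
  shows "open (snd c ` fst c)"
    and "z \<in> snd c ` fst c \<Longrightarrow> chart_inv c z = iwasawa_proj z"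
    and "z \<in> snd c ` fst c \<Longrightarrow> iwasawa_proj z \<in> fst c"
    and "z \<in> snd c ` fst c \<Longrightarrow> snd c (iwasawa_proj z) = z"
    and "x \<in> fst c \<Longrightarrow> iwasawa_proj (snd c x) = x"
proof -
  obtain V where V: "open V" "inj_on iwasawa_proj V" "c = (iwasawa_proj ` V, inv_into V iwasawa_proj)"
    using assms unfolding iwasawa_atlas_def by blast
  have im: "snd c ` fst c = V" and inv: "\<And>z. z \<in> V \<Longrightarrow> snd c (iwasawa_proj z) = z"
    using V(2) by (simp_all add: V(3))
  show "open (snd c ` fst c)" unfolding im by (rule V(1))
  show "iwasawa_proj z \<in> fst c" "snd c (iwasawa_proj z) = z" if "z \<in> snd c ` fst c"
    using that unfolding im by (simp add: V(3), rule inv)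
  show "chart_inv c z = iwasawa_proj z" if "z \<in> snd c ` fst c"
    using that V(2) unfolding im unfolding chart_inv_def
    by (intro inv_into_f_eq) (simp_all add: V(3) inj_on_inv_into)
  show "iwasawa_proj (snd c x) = x" if "x \<in> fst c"
    using that by (simp add: V(3) f_inv_into_f)
qed

text \<open>Any preimage \<open>z\<close> of a point occurs as its coordinate in some chart, so
  local questions at \<open>z\<close> on the cover can be settled in one chart.\<close>

lemma iwasawa_chart_at:
  obtains c where "c \<in> iwasawa_atlas" "iwasawa_proj z \<in> fst c" "snd c (iwasawa_proj z) = z"
proof -
  let ?V = "ball z (1 / 2)"
  let ?c = "(iwasawa_proj ` ?V, inv_into ?V iwasawa_proj)"
  have "?c \<in> iwasawa_atlas"
    unfolding iwasawa_atlas_def using inj_on_iwasawa_proj_ball open_ball by blast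
  moreover have "snd ?c (iwasawa_proj z) = z"
    by (simp add: inj_on_iwasawa_proj_ball)
  ultimately show thesis
    using that[of ?c] by simp
qed

lemma frechet_derivative_chart:
  assumes "c \<in> iwasawa_atlas" "x \<in> fst c"
    "\<And>u. iwasawa_proj u \<in> fst c \<Longrightarrow> snd c (iwasawa_proj u) = u \<Longrightarrow> f (iwasawa_proj u) = g u"
  shows "frechet_derivative (f \<circ> chart_inv c) (at (snd c x)) = frechet_derivative g (at (snd c x))"
  by (rule frechet_derivative_cong_open[OF iwasawa_chart(1)[OF assms(1)]])
    (use assms(2) in \<open>auto simp: iwasawa_chart[OF assms(1)] intro!: assms(3)\<close>)

lemma chart_change_derivative:
  assumes c: "c \<in> iwasawa_atlas" and d: "d \<in> iwasawa_atlas" and x: "x \<in> fst c" "x \<in> fst d"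
  shows "frechet_derivative (snd d \<circ> chart_inv c) (at (snd c x)) =
    (\<lambda>v. frame (snd d x) (coframe (snd c x) v))"
proof -
  let ?z = "snd c x"
  have "iwasawa_proj ?z = iwasawa_proj (snd d x)"
    by (simp add: iwasawa_chart(5) c d x)
  then obtain e where e: "e \<in> gauss_int \<times> gauss_int \<times> gauss_int" "snd d x = heis_mult ?z e"
    unfolding iwasawa_proj_eq_iff by blast
  have inv: "iwasawa_proj (heis_mult u e) = iwasawa_proj u" for u
    using iwasawa_proj_eq_iff e(1) by metis
  \<comment> \<open>The set on which translation by the fixed \<open>e\<close> stays in the range of
    \<open>d\<close>; there the change of charts is this translation.\<close>
  let ?T = "snd c ` fst c \<inter> (\<lambda>u. heis_mult u e) -` (snd d ` fst d)"
  have "continuous_on UNIV (\<lambda>u. heis_mult u e)"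
    by (intro continuous_at_imp_continuous_on ballI has_derivative_continuous[OF heis_mult_has_derivative])
  then have T: "open ?T"
    by (intro open_Int open_vimage iwasawa_chart(1) c d)
  have "?z \<in> ?T"
    using x e(2) by (metis IntI imageI vimageI)
  moreover have "heis_mult u e = (snd d \<circ> chart_inv c) u" if "u \<in> ?T" for u
  proof -
    have "(snd d \<circ> chart_inv c) u = snd d (iwasawa_proj (heis_mult u e))"
      using that by (simp add: iwasawa_chart(2)[OF c] inv)
    also have "\<dots> = heis_mult u e"
      using that by (intro iwasawa_chart(4)[OF d]) simp
    finally show ?thesis ..
  qed
  ultimately have "(snd d \<circ> chart_inv c has_derivative (\<lambda>v. frame (heis_mult ?z e) (coframe ?z v))) (at ?z)"
    by (rule has_derivative_transform_within_open[OF heis_mult_has_derivative T])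
  then show ?thesis
    unfolding e(2) by (rule frechet_derivative_at[symmetric])
qed

section \<open>Smooth maps on the quotient and their derivatives along fields\<close>

text \<open>Smoothness of the lift to the cover, so that calculus takes place on a single Euclidean
  space. The general target covers both functions and component maps.\<close>

definition smooth_map :: "(iwasawa \<Rightarrow> 'b::real_normed_vector) \<Rightarrow> bool" where
  "smooth_map f \<longleftrightarrow> smooth_on UNIV (f \<circ> iwasawa_proj)"

lemma smooth_map_atlas_iff:
  "smooth_map f \<longleftrightarrow> (\<forall>c\<in>iwasawa_atlas. smooth_on (snd c ` fst c) (f \<circ> chart_inv c))"
proof
  assume f: "smooth_map f"
  show "\<forall>c\<in>iwasawa_atlas. smooth_on (snd c ` fst c) (f \<circ> chart_inv c)"
  proof
    fix c assume c: "c \<in> iwasawa_atlas"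
    have "smooth_on (snd c ` fst c) (f \<circ> iwasawa_proj)"
      using f unfolding smooth_map_def by (rule smooth_on_subset) simp
    then show "smooth_on (snd c ` fst c) (f \<circ> chart_inv c)"
      by (rule smooth_on_cong[OF iwasawa_chart(1)[OF c]]) (simp add: iwasawa_chart(2)[OF c])
  qed
next
  assume f: "\<forall>c\<in>iwasawa_atlas. smooth_on (snd c ` fst c) (f \<circ> chart_inv c)"
  show "smooth_map f"
    unfolding smooth_map_def
  proof (rule smooth_on_local)
    fix z
    obtain c where c: "c \<in> iwasawa_atlas" "iwasawa_proj z \<in> fst c" "snd c (iwasawa_proj z) = z"
      by (rule iwasawa_chart_at)
    have "smooth_on (snd c ` fst c) (f \<circ> iwasawa_proj)"
      by (rule smooth_on_cong[OF iwasawa_chart(1)[OF c(1)] f[rule_format, OF c(1)]])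
        (simp add: iwasawa_chart(2)[OF c(1)])
    moreover have "z \<in> snd c ` fst c" using c(2,3) by (metis imageI)
    ultimately show "\<exists>T. open T \<and> z \<in> T \<and> smooth_on T (f \<circ> iwasawa_proj)"
      using iwasawa_chart(1)[OF c(1)] by blast
  qed
qed

lemma smooth_fun_iff: "smooth_fun iwasawa_atlas f \<longleftrightarrow> smooth_map f"
  by (simp add: smooth_fun_def smooth_map_atlas_iff)

lemma smooth_map_const: "smooth_map (\<lambda>x. k)"
  by (simp add: smooth_map_def comp_def smooth_on_const)

lemma smooth_map_add: "smooth_map f \<Longrightarrow> smooth_map g \<Longrightarrow> smooth_map (\<lambda>x. f x + g x)"
  by (simp add: smooth_map_def comp_def smooth_on_add)

lemma smooth_map_bounded_linear: "bounded_linear L \<Longrightarrow> smooth_map f \<Longrightarrow> smooth_map (\<lambda>x. L (f x))"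
  unfolding smooth_map_def comp_def by (rule smooth_on_bounded_linear[OF open_UNIV])

lemma smooth_map_bounded_bilinear:
  "bounded_bilinear B \<Longrightarrow> smooth_map f \<Longrightarrow> smooth_map g \<Longrightarrow> smooth_map (\<lambda>x. B (f x) (g x))"
  unfolding smooth_map_def comp_def by (rule smooth_on_bounded_bilinear[OF open_UNIV])

lemma smooth_map_diff:
  "smooth_map f \<Longrightarrow> smooth_map g \<Longrightarrow> smooth_map (\<lambda>x. f x - g x)"
  using smooth_map_add[of f "\<lambda>x. - g x"]
    smooth_map_bounded_linear[OF bounded_linear_minus[OF bounded_linear_ident], of g] by simp

text \<open>
  The derivative of \<open>f\<close> along the vector field with components \<open>a\<close>, computed on the universal
  cover; for smooth \<open>f\<close> the choice of the preimage is irrelevant (\<open>along_proj\<close>).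
\<close>

definition along :: "(iwasawa \<Rightarrow> complex3) \<Rightarrow> (iwasawa \<Rightarrow> 'b::real_normed_vector) \<Rightarrow> iwasawa \<Rightarrow> 'b" where
  "along a f x = (let z = SOME z. iwasawa_proj z = x
     in frechet_derivative (f \<circ> iwasawa_proj) (at z) (frame z (a x)))"

lemma smooth_map_has_derivative:
  "smooth_map f \<Longrightarrow> (f \<circ> iwasawa_proj has_derivative frechet_derivative (f \<circ> iwasawa_proj) (at z)) (at z)"
  unfolding smooth_map_def by (rule smooth_on_has_derivative) auto

lemma along_proj:
  assumes "smooth_map f"
  shows "along a f (iwasawa_proj z) =
    frechet_derivative (f \<circ> iwasawa_proj) (at z) (frame z (a (iwasawa_proj z)))"
proof -
  let ?F = "f \<circ> iwasawa_proj"
  define w where "w = (SOME w. iwasawa_proj w = iwasawa_proj z)"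
  have "iwasawa_proj w = iwasawa_proj z" unfolding w_def by (rule someI) simp
  then obtain e where e: "e \<in> gauss_int \<times> gauss_int \<times> gauss_int" "w = heis_mult z e"
    using iwasawa_proj_eq_iff by metis
  have "iwasawa_proj (heis_mult u e) = iwasawa_proj u" for u
    using iwasawa_proj_eq_iff e(1) by metis
  \<comment> \<open>The lift is invariant under the lattice element joining the two preimages; the
    chain rule with the invariance of the frame then matches the two derivatives.\<close>
  then have F: "?F \<circ> (\<lambda>u. heis_mult u e) = ?F" by (simp add: fun_eq_iff)
  have "(?F \<circ> (\<lambda>u. heis_mult u e) has_derivative
      frechet_derivative ?F (at w) \<circ> (\<lambda>v. frame w (coframe z v))) (at z)"
    unfolding e(2) by (rule diff_chain_at[OF heis_mult_has_derivative smooth_map_has_derivative[OF assms]])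
  then have "frechet_derivative ?F (at z) = frechet_derivative ?F (at w) \<circ> (\<lambda>v. frame w (coframe z v))"
    unfolding F by (rule frechet_derivative_at[symmetric])
  then show ?thesis
    by (simp add: along_def w_def[symmetric])
qed

lemma along_add_left:
  "smooth_map f \<Longrightarrow> along (\<lambda>x. a x + b x) f x = along a f x + along b f x"
  by (rule iwasawa_proj_surj[of x])
    (simp add: along_proj linear_add[OF frame_linear] linear_add[OF has_derivative_linear[OF smooth_map_has_derivative]])

lemma along_scaleR_left:
  "smooth_map f \<Longrightarrow> along (\<lambda>x. h x *\<^sub>R a x) f x = h x *\<^sub>R along a f x"
  by (rule iwasawa_proj_surj[of x])
    (simp add: along_proj linear_cmul[OF frame_linear] linear_cmul[OF has_derivative_linear[OF smooth_map_has_derivative]])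

lemma along_bounded_linear:
  assumes "bounded_linear L" "smooth_map f"
  shows "along a (\<lambda>x. L (f x)) x = L (along a f x)"
proof -
  have "((\<lambda>x. L (f x)) \<circ> iwasawa_proj has_derivative
      (\<lambda>v. L (frechet_derivative (f \<circ> iwasawa_proj) (at z) v))) (at z)" for z
    using bounded_linear.has_derivative[OF assms(1) smooth_map_has_derivative[OF assms(2)]]
    by (simp add: comp_def)
  note D = frechet_derivative_at[OF this, symmetric]
  show ?thesis
    by (rule iwasawa_proj_surj[of x]) (simp add: along_proj D assms smooth_map_bounded_linear)
qed

lemma along_add:
  assumes "smooth_map f" "smooth_map g"
  shows "along a (\<lambda>x. f x + g x) x = along a f x + along a g x"
proof -
  have "((\<lambda>x. f x + g x) \<circ> iwasawa_proj has_derivative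
      (\<lambda>v. frechet_derivative (f \<circ> iwasawa_proj) (at z) v + frechet_derivative (g \<circ> iwasawa_proj) (at z) v)) (at z)" for z
    using has_derivative_add[OF assms[THEN smooth_map_has_derivative]]
    by (simp add: comp_def)
  note D = frechet_derivative_at[OF this, symmetric]
  show ?thesis
    by (rule iwasawa_proj_surj[of x]) (simp add: along_proj D assms smooth_map_add)
qed

lemma along_bounded_bilinear:
  assumes "bounded_bilinear B" "smooth_map f" "smooth_map g"
  shows "along a (\<lambda>x. B (f x) (g x)) x = B (f x) (along a g x) + B (along a f x) (g x)"
proof -
  have "((\<lambda>x. B (f x) (g x)) \<circ> iwasawa_proj has_derivative
      (\<lambda>v. B (f (iwasawa_proj z)) (frechet_derivative (g \<circ> iwasawa_proj) (at z) v) +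
        B (frechet_derivative (f \<circ> iwasawa_proj) (at z) v) (g (iwasawa_proj z)))) (at z)" for z
    using bounded_bilinear.FDERIV[OF assms(1) assms(2,3)[THEN smooth_map_has_derivative]]
    by (simp add: comp_def)
  note D = frechet_derivative_at[OF this, symmetric]
  show ?thesis
    by (rule iwasawa_proj_surj[of x]) (simp add: along_proj D assms smooth_map_bounded_bilinear)
qed

lemma smooth_on_frame:
  "open S \<Longrightarrow> smooth_on S f \<Longrightarrow> smooth_on S (\<lambda>z. frame z (f z))"
  unfolding frame_def
  by (intro smooth_on_add smooth_on_bounded_bilinear[OF _ bounded_bilinear_shear] smooth_on_id)

lemma smooth_on_coframe:
  assumes "open S" "smooth_on S f"
  shows "smooth_on S (\<lambda>z. coframe z (f z))"
proof -
  have "smooth_on S (\<lambda>z. f z + - shear z (f z))"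
    by (intro smooth_on_add smooth_on_bounded_linear[OF _ bounded_linear_minus[OF bounded_linear_ident]]
        smooth_on_bounded_bilinear[OF _ bounded_bilinear_shear] smooth_on_id assms)
  then show ?thesis by (simp add: coframe_def)
qed

lemma along_comp_proj:
  "smooth_map f \<Longrightarrow> along a f \<circ> iwasawa_proj =
    (\<lambda>z. frechet_derivative (f \<circ> iwasawa_proj) (at z) (frame z ((a \<circ> iwasawa_proj) z)))"
  by (simp add: fun_eq_iff along_proj)

lemma smooth_map_along: "smooth_map a \<Longrightarrow> smooth_map f \<Longrightarrow> smooth_map (along a f)"
  unfolding smooth_map_def[of "along a f"]
  by (simp only: along_comp_proj)
    (intro smooth_on_frechet_derivative smooth_on_frame open_UNIV; simp add: smooth_map_def comp_def)

section \<open>The bracket in the frame\<close>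

text \<open>Minus the matrix commutator of the Lie algebra, which is the sign that right-invariant
  fields produce.\<close>

definition lie :: "complex3 \<Rightarrow> complex3 \<Rightarrow> complex3" where
  "lie a b = (0, snd (snd a) * fst b - snd (snd b) * fst a, 0)"

lemma bounded_bilinear_lie: "bounded_bilinear lie"
  unfolding bilinear_conv_bounded_bilinear[symmetric] bilinear_def lie_def
  by (auto intro!: linearI simp: algebra_simps)

definition frame_bracket :: "(iwasawa \<Rightarrow> complex3) \<Rightarrow> (iwasawa \<Rightarrow> complex3) \<Rightarrow> iwasawa \<Rightarrow> complex3" where
  "frame_bracket a b x = along a b x - along b a x + lie (a x) (b x)"

lemma frame_has_derivative:
  assumes "smooth_map a"
  shows "((\<lambda>z. frame z (a (iwasawa_proj z))) has_derivative
    (\<lambda>v. frame z (frechet_derivative (a \<circ> iwasawa_proj) (at z) v) + shear v (a (iwasawa_proj z)))) (at z)"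
proof -
  have a: "((\<lambda>z. a (iwasawa_proj z)) has_derivative frechet_derivative (a \<circ> iwasawa_proj) (at z)) (at z)"
    using smooth_map_has_derivative[OF assms] by (simp add: comp_def)
  show ?thesis
    unfolding frame_def
    by (rule has_derivative_eq_rhs[OF has_derivative_add[OF a
          bounded_bilinear.FDERIV[OF bounded_bilinear_shear has_derivative_ident a]]]) auto
qed

text \<open>The right-hand side is the coordinate bracket of the lifted fields, to be matched both
  with \<open>bracket\<close> in a chart and with the commutator of derivations.\<close>

lemma frame_bracket_lift:
  assumes "smooth_map a" "smooth_map b" and x: "x = iwasawa_proj z"
  shows "frame z (frame_bracket a b x) =
    (frame z (frechet_derivative (b \<circ> iwasawa_proj) (at z) (frame z (a x))) + shear (frame z (a x)) (b x))
    - (frame z (frechet_derivative (a \<circ> iwasawa_proj) (at z) (frame z (b x))) + shear (frame z (b x)) (a x))"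
proof -
  \<comment> \<open>\<open>shear\<close> reads only the outer entries, which \<open>frame z\<close>
    leaves alone, and \<open>frame z\<close> fixes vectors in the central direction.\<close>
  have "shear (frame z a) b - shear (frame z b) a = frame z (lie a b)" for a b
    by (simp add: frame_def shear_def lie_def)
  then show ?thesis
    by (simp add: frame_bracket_def x along_proj assms linear_add[OF frame_linear] linear_diff[OF frame_linear])
qed

text \<open>The second-order terms cancel by symmetry of the second derivative; the remaining ones
  are the derivative of \<open>f\<close> along the coordinate bracket.\<close>

lemma along_commutator:
  fixes f :: "iwasawa \<Rightarrow> 'b::euclidean_space"
  assumes "smooth_map a" "smooth_map b" "smooth_map f"
  shows "along a (along b f) x - along b (along a f) x = along (frame_bracket a b) f x"
proof -
  obtain z where x: "x = iwasawa_proj z" by (rule iwasawa_proj_surj)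
  let ?F = "f \<circ> iwasawa_proj"
  let ?A = "\<lambda>a. frame z (a x)"
  let ?H = "\<lambda>u v. frechet_derivative (\<lambda>y. frechet_derivative ?F (at y) v) (at z) u"
  have F: "smooth_on UNIV ?F" using assms(3) by (simp add: smooth_map_def)
  have D: "along a (along b f) x = ?H (?A a) (?A b) + frechet_derivative ?F (at z)
      (frame z (frechet_derivative (b \<circ> iwasawa_proj) (at z) (?A a)) + shear (?A a) (b x))"
    if ab: "smooth_map a" "smooth_map b" for a b
  proof -
    have "(along b f \<circ> iwasawa_proj has_derivative (\<lambda>v. ?H v (?A b) + frechet_derivative ?F (at z)
        (frame z (frechet_derivative (b \<circ> iwasawa_proj) (at z) v) + shear v (b x)))) (at z)"
      using has_derivative_frechet_derivative[OF F frame_has_derivative[OF ab(2)]]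
      by (simp only: along_comp_proj[OF assms(3)] comp_apply x)
    note D = frechet_derivative_at[OF this, symmetric]
    have "along a (along b f) x = frechet_derivative (along b f \<circ> iwasawa_proj) (at z) (?A a)"
      unfolding x by (rule along_proj[OF smooth_map_along[OF ab(2) assms(3)]])
    then show ?thesis unfolding D .
  qed
  have lin: "linear (frechet_derivative ?F (at z))"
    by (rule has_derivative_linear[OF smooth_map_has_derivative[OF assms(3)]])
  have "along (frame_bracket a b) f x = frechet_derivative ?F (at z) (frame z (frame_bracket a b x))"
    unfolding x by (rule along_proj[OF assms(3)])
  then show ?thesis
    unfolding D[OF assms(1,2)] D[OF assms(2,1)] frame_bracket_lift[OF assms(1,2) x] linear_diff[OF lin]
      symmetric_second_derivative[OF F, of "?A a" z "?A b"]
    by simp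
qed

section \<open>Vector fields in terms of the frame\<close>

definition frame_field :: "(iwasawa \<Rightarrow> complex3) \<Rightarrow> (iwasawa, complex3) field" where
  "frame_field a = (\<lambda>c x. if c \<in> iwasawa_atlas \<and> x \<in> fst c then frame (snd c x) (a x) else 0)"

text \<open>One chosen chart per point makes this linear on arbitrary fields; on
  \<open>vfields\<close> the choice is irrelevant by \<open>components_chart\<close>.\<close>

definition components :: "(iwasawa, complex3) field \<Rightarrow> iwasawa \<Rightarrow> complex3" where
  "components X x = (let c = SOME c. c \<in> iwasawa_atlas \<and> x \<in> fst c in coframe (snd c x) (X c x))"

lemma some_chart:
  "(SOME c. c \<in> iwasawa_atlas \<and> x \<in> fst c) \<in> iwasawa_atlas"
  "x \<in> fst (SOME c. c \<in> iwasawa_atlas \<and> x \<in> fst c)"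
proof -
  have "\<exists>c. c \<in> iwasawa_atlas \<and> x \<in> fst c"
    by (rule iwasawa_proj_surj[of x], rule iwasawa_chart_at) blast
  from someI_ex[OF this] show "(SOME c. c \<in> iwasawa_atlas \<and> x \<in> fst c) \<in> iwasawa_atlas"
    "x \<in> fst (SOME c. c \<in> iwasawa_atlas \<and> x \<in> fst c)" by auto
qed

lemma components_frame_field [simp]: "components (frame_field a) = a"
  by (rule ext) (simp add: components_def frame_field_def some_chart)

lemma components_add [simp]: "components (X + Y) = (\<lambda>x. components X x + components Y x)"
  by (rule ext) (simp add: components_def Let_def linear_add[OF coframe_linear])

lemma components_minus [simp]: "components (- X) = (\<lambda>x. - components X x)"
  by (rule ext) (simp add: components_def Let_def linear_neg[OF coframe_linear])

lemma components_diff [simp]: "components (X - Y) = (\<lambda>x. components X x - components Y x)"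
  by (rule ext) (simp add: components_def Let_def linear_diff[OF coframe_linear])

lemma components_fscale [simp]: "components (fscale f X) = (\<lambda>x. f x *\<^sub>R components X x)"
  by (rule ext) (simp add: components_def Let_def fscale_def linear_cmul[OF coframe_linear])

lemma vfieldsD:
  assumes "X \<in> vfields A"
  shows "c \<notin> A \<or> x \<notin> fst c \<Longrightarrow> X c x = 0"
    and "c \<in> A \<Longrightarrow> smooth_on (snd c ` fst c) (X c \<circ> chart_inv c)"
    and "c \<in> A \<Longrightarrow> d \<in> A \<Longrightarrow> x \<in> fst c \<Longrightarrow> x \<in> fst d \<Longrightarrow>
      X d x = frechet_derivative (snd d \<circ> chart_inv c) (at (snd c x)) (X c x)"
  using assms unfolding vfields_def by blast+

lemma components_chart:
  assumes "X \<in> vfields iwasawa_atlas" "c \<in> iwasawa_atlas" "x \<in> fst c"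
  shows "components X x = coframe (snd c x) (X c x)"
proof -
  have "X d x = frame (snd d x) (coframe (snd c x) (X c x))"
    if "d \<in> iwasawa_atlas" "x \<in> fst d" for d
    using vfieldsD(3)[OF assms(1,2) that(1) assms(3) that(2)]
      chart_change_derivative[OF assms(2) that(1) assms(3) that(2)] by simp
  from this[OF some_chart] show ?thesis by (simp add: components_def)
qed

lemma frame_field_components [simp]:
  assumes "X \<in> vfields iwasawa_atlas"
  shows "frame_field (components X) = X"
proof (intro ext)
  fix c x
  show "frame_field (components X) c x = X c x"
    using vfieldsD(1)[OF assms, of c x] by (auto simp: frame_field_def components_chart[OF assms])
qed

lemma frame_field_chart:
  assumes "c \<in> iwasawa_atlas" "iwasawa_proj u \<in> fst c" "snd c (iwasawa_proj u) = u"
  shows "frame_field a c (iwasawa_proj u) = frame u (a (iwasawa_proj u))"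
  using assms by (simp add: frame_field_def)

lemma frame_field_in_vfields [simp]:
  assumes "smooth_map a"
  shows "frame_field a \<in> vfields iwasawa_atlas"
proof -
  have "smooth_on (snd c ` fst c) (frame_field a c \<circ> chart_inv c)" if c: "c \<in> iwasawa_atlas" for c
  proof -
    have "smooth_on UNIV (\<lambda>z. frame z ((a \<circ> iwasawa_proj) z))"
      using assms by (intro smooth_on_frame) (auto simp: smooth_map_def comp_def)
    then have "smooth_on (snd c ` fst c) (\<lambda>z. frame z ((a \<circ> iwasawa_proj) z))"
      by (rule smooth_on_subset) simp
    then show ?thesis
      by (rule smooth_on_cong[OF iwasawa_chart(1)[OF c]])
        (simp add: iwasawa_chart(2,3,4)[OF c] frame_field_def c)
  qed
  moreover have "frame_field a d x = frechet_derivative (snd d \<circ> chart_inv c) (at (snd c x)) (frame_field a c x)"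
    if "c \<in> iwasawa_atlas" "d \<in> iwasawa_atlas" "x \<in> fst c" "x \<in> fst d" for c d x
    using that by (simp add: chart_change_derivative frame_field_def)
  moreover have "frame_field a c x = 0" if "c \<notin> iwasawa_atlas \<or> x \<notin> fst c" for c x
    using that by (auto simp: frame_field_def)
  ultimately show ?thesis
    unfolding vfields_def by blast
qed

lemma smooth_map_components:
  assumes "X \<in> vfields iwasawa_atlas"
  shows "smooth_map (components X)"
  unfolding smooth_map_atlas_iff
proof
  fix c assume c: "c \<in> iwasawa_atlas"
  have "smooth_on (snd c ` fst c) (X c \<circ> chart_inv c)"
    by (rule vfieldsD(2)[OF assms c])
  then have "smooth_on (snd c ` fst c) (\<lambda>z. coframe z ((X c \<circ> chart_inv c) z))"
    by (rule smooth_on_coframe[OF iwasawa_chart(1)[OF c]])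
  then show "smooth_on (snd c ` fst c) (components X \<circ> chart_inv c)"
    by (rule smooth_on_cong[OF iwasawa_chart(1)[OF c]])
      (simp add: iwasawa_chart(2,3,4)[OF c] components_chart[OF assms c])
qed

section \<open>Derivations, brackets and algebra of fields in components\<close>

lemma vderiv_eq_along:
  assumes "X \<in> vfields iwasawa_atlas" "smooth_map f"
  shows "vderiv iwasawa_atlas X f x = along (components X) f x"
proof -
  define c where "c = (SOME c. c \<in> iwasawa_atlas \<and> x \<in> fst c)"
  have c: "c \<in> iwasawa_atlas" "x \<in> fst c" unfolding c_def by (rule some_chart)+
  have "frechet_derivative (f \<circ> chart_inv c) (at (snd c x)) = frechet_derivative (f \<circ> iwasawa_proj) (at (snd c x))"
    by (rule frechet_derivative_chart[OF c]) simp
  moreover have "X c x = frame (snd c x) (components X x)"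
    by (simp add: components_chart[OF assms(1) c])
  moreover have "along (components X) f x = frechet_derivative (f \<circ> iwasawa_proj) (at (snd c x)) (frame (snd c x) (components X x))"
    using along_proj[OF assms(2), of "components X" "snd c x"] by (simp add: iwasawa_chart(5)[OF c])
  ultimately show ?thesis by (simp add: vderiv_def c_def[symmetric])
qed

lemma bracket_frame_field:
  assumes "smooth_map a" "smooth_map b"
  shows "bracket iwasawa_atlas (frame_field a) (frame_field b) = frame_field (frame_bracket a b)"
proof (intro ext)
  fix c x
  show "bracket iwasawa_atlas (frame_field a) (frame_field b) c x = frame_field (frame_bracket a b) c x"
  proof (cases "c \<in> iwasawa_atlas \<and> x \<in> fst c")
    case True
    then have c: "c \<in> iwasawa_atlas" "x \<in> fst c" by auto
    let ?z = "snd c x"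
    have x: "x = iwasawa_proj ?z" by (simp add: iwasawa_chart(5)[OF c])
    have "frechet_derivative (frame_field a c \<circ> chart_inv c) (at ?z) =
        (\<lambda>v. frame ?z (frechet_derivative (a \<circ> iwasawa_proj) (at ?z) v) + shear v (a x))"
      if "smooth_map a" for a
    proof -
      have "frechet_derivative (frame_field a c \<circ> chart_inv c) (at ?z) =
          frechet_derivative (\<lambda>z. frame z (a (iwasawa_proj z))) (at ?z)"
        by (rule frechet_derivative_chart[OF c]) (rule frame_field_chart[OF c(1)])
      also have "\<dots> = (\<lambda>v. frame ?z (frechet_derivative (a \<circ> iwasawa_proj) (at ?z) v) + shear v (a (iwasawa_proj ?z)))"
        by (rule frechet_derivative_at[symmetric]) (rule frame_has_derivative[OF that])
      finally show ?thesis by (simp add: iwasawa_chart(5)[OF c])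
    qed
    note d = this[OF assms(1)] this[OF assms(2)]
    have f: "frame_field a c x = frame ?z (a x)" for a
      by (simp add: frame_field_def c)
    have "bracket iwasawa_atlas (frame_field a) (frame_field b) c x =
        frechet_derivative (frame_field b c \<circ> chart_inv c) (at ?z) (frame_field a c x)
        - frechet_derivative (frame_field a c \<circ> chart_inv c) (at ?z) (frame_field b c x)"
      by (simp add: bracket_def c)
    also have "\<dots> = frame_field (frame_bracket a b) c x"
      unfolding d f frame_bracket_lift[OF assms x] ..
    finally show ?thesis .
  qed (auto simp: bracket_def frame_field_def)
qed

lemma frame_field_add: "frame_field (\<lambda>x. a x + b x) = frame_field a + frame_field b"
  by (intro ext) (simp add: frame_field_def linear_add[OF frame_linear])

lemma frame_field_minus: "frame_field (\<lambda>x. - a x) = - frame_field a"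
  by (intro ext) (simp add: frame_field_def linear_neg[OF frame_linear])

lemma frame_field_diff: "frame_field (\<lambda>x. a x - b x) = frame_field a - frame_field b"
  by (intro ext) (simp add: frame_field_def linear_diff[OF frame_linear])

lemma frame_field_zero: "frame_field (\<lambda>x. 0) = 0"
  by (intro ext) (simp add: frame_field_def linear_0[OF frame_linear])

lemma frame_field_scaleR: "frame_field (\<lambda>x. f x *\<^sub>R a x) = fscale f (frame_field a)"
  by (intro ext) (simp add: frame_field_def fscale_def linear_cmul[OF frame_linear])

lemma vfields_iwasawa_cases:
  assumes "X \<in> vfields iwasawa_atlas"
  obtains a where "X = frame_field a" "smooth_map a"
  using assms that[of "components X"] by (simp add: smooth_map_components)

lemma vfields_iwasawa_closed [simp]:
  assumes "X \<in> vfields iwasawa_atlas"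
  shows "- X \<in> vfields iwasawa_atlas"
    and "Y \<in> vfields iwasawa_atlas \<Longrightarrow> X + Y \<in> vfields iwasawa_atlas"
    and "Y \<in> vfields iwasawa_atlas \<Longrightarrow> X - Y \<in> vfields iwasawa_atlas"
    and "smooth_map f \<Longrightarrow> fscale f X \<in> vfields iwasawa_atlas"
proof -
  obtain a where a: "X = frame_field a" "smooth_map a" using assms by (rule vfields_iwasawa_cases)
  show "- X \<in> vfields iwasawa_atlas"
    unfolding a(1) frame_field_minus[symmetric]
    by (intro frame_field_in_vfields smooth_map_bounded_linear[OF bounded_linear_minus] bounded_linear_ident a(2))
  show "fscale f X \<in> vfields iwasawa_atlas" if "smooth_map f"
    unfolding a(1) frame_field_scaleR[symmetric]
    by (intro frame_field_in_vfields smooth_map_bounded_bilinear[OF bounded_bilinear_scaleR] that a(2))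
  assume "Y \<in> vfields iwasawa_atlas"
  then obtain b where b: "Y = frame_field b" "smooth_map b" by (rule vfields_iwasawa_cases)
  show "X + Y \<in> vfields iwasawa_atlas"
    unfolding a(1) b(1) frame_field_add[symmetric]
    by (intro frame_field_in_vfields smooth_map_add a(2) b(2))
  show "X - Y \<in> vfields iwasawa_atlas"
    unfolding a(1) b(1) frame_field_diff[symmetric]
    by (intro frame_field_in_vfields smooth_map_diff a(2) b(2))
qed

section \<open>Connections with constant coefficients\<close>

definition frame_metric ::
  "(iwasawa, complex3) field \<Rightarrow> (iwasawa, complex3) field \<Rightarrow> iwasawa \<Rightarrow> real" where
  "frame_metric X Y = (\<lambda>x. components X x \<bullet> components Y x)"

text \<open>\<open>B\<close> holds the constant connection coefficients in the frame; with
  \<open>B = 0\<close> the frame is parallel.\<close>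

definition frame_connection ::
  "(complex3 \<Rightarrow> complex3 \<Rightarrow> complex3) \<Rightarrow>
   (iwasawa, complex3) field \<Rightarrow> (iwasawa, complex3) field \<Rightarrow> (iwasawa, complex3) field" where
  "frame_connection B X Y = frame_field (\<lambda>x. along (components X) (components Y) x
     + B (components X x) (components Y x))"

definition frame_curvature ::
  "(complex3 \<Rightarrow> complex3 \<Rightarrow> complex3) \<Rightarrow> complex3 \<Rightarrow> complex3 \<Rightarrow> complex3 \<Rightarrow> complex3" where
  "frame_curvature B a b c = B a (B b c) - B b (B a c) - B (lie a b) c"

lemma riemannian_metric_frame: "riemannian_metric iwasawa_atlas frame_metric"
  unfolding riemannian_metric_def smooth_fun_iff
proof (intro conjI ballI allI impI)
  fix X Y assume "X \<in> vfields iwasawa_atlas" "Y \<in> vfields iwasawa_atlas"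
  then show "smooth_map (frame_metric X Y)" "frame_metric X Y = frame_metric Y X"
    unfolding frame_metric_def
    by (intro smooth_map_bounded_bilinear[OF bounded_bilinear_inner] smooth_map_components)
      (auto simp: inner_commute)
next
  fix X c x
  assume X: "X \<in> vfields iwasawa_atlas" "c \<in> iwasawa_atlas" "x \<in> fst c" "X c x \<noteq> 0"
  have "components X x \<noteq> 0"
    using X(4) linear_0[OF frame_linear] by (metis components_chart[OF X(1-3)] frame_coframe)
  then show "0 < frame_metric X X x" by (simp add: frame_metric_def)
qed (auto simp: frame_metric_def inner_add_left fun_eq_iff)

lemma smooth_map_frame_connection:
  assumes "bounded_bilinear B" "smooth_map a" "smooth_map b"
  shows "smooth_map (\<lambda>x. along a b x + B (a x) (b x))"
  by (intro smooth_map_add smooth_map_along[OF assms(2,3)] smooth_map_bounded_bilinear[OF assms])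

lemma linear_connection_frame:
  assumes "bounded_bilinear B"
  shows "linear_connection iwasawa_atlas (frame_connection B)"
proof -
  interpret B: bounded_bilinear B by (rule assms)
  note bilin = along_bounded_bilinear[OF bounded_bilinear_scaleR]
  show ?thesis
    unfolding linear_connection_def smooth_fun_iff
  proof (intro conjI ballI allI impI)
    fix X Y assume "X \<in> vfields iwasawa_atlas" "Y \<in> vfields iwasawa_atlas"
    then show "frame_connection B X Y \<in> vfields iwasawa_atlas"
      unfolding frame_connection_def
      by (intro frame_field_in_vfields smooth_map_frame_connection assms smooth_map_components)
  next
    fix X Y Z assume "X \<in> vfields iwasawa_atlas" "Y \<in> vfields iwasawa_atlas" "Z \<in> vfields iwasawa_atlas"
    note c = this[THEN smooth_map_components]
    show "frame_connection B (X + Y) Z = frame_connection B X Z + frame_connection B Y Z"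
      "frame_connection B X (Y + Z) = frame_connection B X Y + frame_connection B X Z"
      unfolding frame_connection_def frame_field_add[symmetric]
      by (simp_all add: along_add_left along_add c B.add_left B.add_right add_ac)
  next
    fix f :: "iwasawa \<Rightarrow> real" and X Y
    assume a: "smooth_map f \<and> X \<in> vfields iwasawa_atlas \<and> Y \<in> vfields iwasawa_atlas"
    then have c: "smooth_map f" "X \<in> vfields iwasawa_atlas" "smooth_map (components X)" "smooth_map (components Y)"
      "Y \<in> vfields iwasawa_atlas"
      by (auto intro: smooth_map_components)
    \<comment> \<open>Scaled copies of \<open>Y\<close> are put in frame form so that both sides can
      be compared under one \<open>frame_field\<close>.\<close>
    have Y: "fscale g Y = frame_field (\<lambda>x. g x *\<^sub>R components Y x)" for g
      using c(5) by (simp add: frame_field_scaleR)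
    show "frame_connection B (fscale f X) Y = fscale f (frame_connection B X Y)"
      unfolding frame_connection_def frame_field_scaleR[symmetric]
      by (simp add: along_scaleR_left c B.scaleR_left scaleR_add_right)
    show "frame_connection B X (fscale f Y) =
        fscale (vderiv iwasawa_atlas X f) Y + fscale f (frame_connection B X Y)"
      unfolding Y
      unfolding frame_connection_def frame_field_scaleR[symmetric] frame_field_add[symmetric]
      by (simp add: bilin c B.scaleR_right scaleR_add_right vderiv_eq_along add_ac)
  qed
qed

text \<open>The product rule accounts for the derivatives of the components; what remains is
  skewness of each \<open>B a\<close>.\<close>

lemma parallel_metric_frame:
  assumes "\<And>a b c. B a b \<bullet> c + b \<bullet> B a c = 0"
  shows "parallel_metric iwasawa_atlas frame_metric (frame_connection B)"
  unfolding parallel_metric_def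
proof (intro ballI)
  fix X Y Z assume X: "X \<in> vfields iwasawa_atlas" "Y \<in> vfields iwasawa_atlas" "Z \<in> vfields iwasawa_atlas"
  note c = X[THEN smooth_map_components]
  have "along (components X) (\<lambda>x. components Y x \<bullet> components Z x) x =
      (along (components X) (components Y) x + B (components X x) (components Y x)) \<bullet> components Z x +
      components Y x \<bullet> (along (components X) (components Z) x + B (components X x) (components Z x))" for x
    using assms[of "components X x" "components Y x" "components Z x"]
    by (simp add: along_bounded_bilinear[OF bounded_bilinear_inner] c inner_add_left inner_add_right)
  moreover have "smooth_map (\<lambda>x. components Y x \<bullet> components Z x)"
    by (rule smooth_map_bounded_bilinear[OF bounded_bilinear_inner c(2,3)])
  ultimately show "vderiv iwasawa_atlas X (frame_metric Y Z) =
      frame_metric (frame_connection B X Y) Z + frame_metric Y (frame_connection B X Z)"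
    by (simp add: fun_eq_iff frame_metric_def frame_connection_def vderiv_eq_along X(1))
qed

lemma bracket_components:
  assumes "X \<in> vfields iwasawa_atlas" "Y \<in> vfields iwasawa_atlas"
  shows "bracket iwasawa_atlas X Y = frame_field (frame_bracket (components X) (components Y))"
  using bracket_frame_field[OF assms[THEN smooth_map_components]] by (simp add: assms)

lemma torsion_frame:
  assumes "X \<in> vfields iwasawa_atlas" "Y \<in> vfields iwasawa_atlas"
  shows "torsion iwasawa_atlas (frame_connection B) X Y =
    frame_field (\<lambda>x. B (components X x) (components Y x) - B (components Y x) (components X x)
      - lie (components X x) (components Y x))"
  unfolding torsion_def bracket_components[OF assms] frame_connection_def frame_field_diff[symmetric]
  by (simp add: frame_bracket_def algebra_simps)

lemma curvature_frame:
  assumes "bounded_bilinear B"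
    and "X \<in> vfields iwasawa_atlas" "Y \<in> vfields iwasawa_atlas" "Z \<in> vfields iwasawa_atlas"
  shows "curvature iwasawa_atlas frame_metric (frame_connection B) X Y Z W x =
    frame_curvature B (components X x) (components Y x) (components Z x) \<bullet> components W x"
proof -
  interpret B: bounded_bilinear B by (rule assms)
  let ?a = "components X" and ?b = "components Y" and ?c = "components Z"
  note c = assms(2-4)[THEN smooth_map_components]
  have D: "along a (\<lambda>x. along b ?c x + B (b x) (?c x)) x = along a (along b ?c) x
      + B (b x) (along a ?c x) + B (along a b x) (?c x)" if "smooth_map a" "smooth_map b" for a b
    using that c(3)
    by (simp add: along_add along_bounded_bilinear[OF assms(1)] smooth_map_along
        smooth_map_bounded_bilinear[OF assms(1)])
  \<comment> \<open>The mixed terms \<open>B b (along a c)\<close> cancel after antisymmetrisation,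
    and those differentiating \<open>a\<close> or \<open>b\<close> cancel against the bracket up to
    \<open>B (lie a b) c\<close>. The remaining derivatives of \<open>c\<close> vanish by
    \<open>along_commutator\<close>.\<close>
  have "components (frame_connection B X (frame_connection B Y Z) - frame_connection B Y (frame_connection B X Z)
      - frame_connection B (bracket iwasawa_atlas X Y) Z) x =
      along ?a (along ?b ?c) x - along ?b (along ?a ?c) x - along (frame_bracket ?a ?b) ?c x
      + frame_curvature B (?a x) (?b x) (?c x)"
    by (simp add: frame_connection_def bracket_components assms(2,3) D c frame_curvature_def
        frame_bracket_def[of ?a ?b x] B.add_left B.add_right B.diff_left algebra_simps)
  then show ?thesis
    by (simp add: curvature_def frame_metric_def along_commutator c)
qed

section \<open>The quasi-Kaehler structure\<close>

definition acs0 :: "complex3 \<Rightarrow> complex3" where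
  "acs0 a = (\<i> * fst a, - \<i> * fst (snd a), \<i> * snd (snd a))"

definition frame_acs :: "(iwasawa, complex3) field \<Rightarrow> (iwasawa, complex3) field" where
  "frame_acs X = frame_field (\<lambda>x. acs0 (components X x))"

lemma linear_acs0: "linear acs0"
  by (auto intro!: linearI simp: acs0_def algebra_simps)

lemmas bounded_linear_acs0 = linear_acs0[unfolded linear_conv_bounded_linear]

lemmas acs0_linear = linear_add[OF linear_acs0] linear_diff[OF linear_acs0]
  linear_neg[OF linear_acs0] linear_cmul[OF linear_acs0]

lemma acs0_acs0 [simp]: "acs0 (acs0 a) = - a"
  by (simp add: acs0_def prod_eq_iff)

lemma acs0_skew: "acs0 a \<bullet> b = - (a \<bullet> acs0 b)"
  by (simp add: acs0_def inner_prod_def inner_complex_def)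

lemma components_frame_acs [simp]: "components (frame_acs X) = (\<lambda>x. acs0 (components X x))"
  by (simp add: frame_acs_def)

lemma frame_acs_in_vfields [simp]: "X \<in> vfields iwasawa_atlas \<Longrightarrow> frame_acs X \<in> vfields iwasawa_atlas"
  unfolding frame_acs_def
  by (intro frame_field_in_vfields smooth_map_bounded_linear[OF bounded_linear_acs0] smooth_map_components)

lemma vfields_iwasawa_eqI:
  "X \<in> vfields iwasawa_atlas \<Longrightarrow> Y \<in> vfields iwasawa_atlas \<Longrightarrow>
    (\<And>x. components X x = components Y x) \<Longrightarrow> X = Y"
  by (metis ext frame_field_components)

lemma almost_complex_frame: "almost_complex iwasawa_atlas frame_acs"
  unfolding almost_complex_def smooth_fun_iff
  by (auto intro!: vfields_iwasawa_eqI simp: acs0_linear)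

lemma almost_hermitian_frame:
  "almost_hermitian iwasawa_atlas frame_metric frame_acs (\<lambda>X. frame_metric (frame_acs X))"
  unfolding almost_hermitian_def
  by (simp add: riemannian_metric_frame almost_complex_frame)
    (simp add: frame_metric_def acs0_skew)

text \<open>\<open>lie\<close> is complex bilinear in the outer entries, where \<open>acs0\<close>
  is multiplication by i, and takes values in the middle entry, where it is multiplication by
  -i.\<close>

lemma lie_acs0 [simp]: "lie (acs0 a) b = - acs0 (lie a b)" "lie a (acs0 b) = - acs0 (lie a b)"
  by (simp_all add: lie_def acs0_def algebra_simps)

lemma ext_deriv2_frame:
  assumes "X \<in> vfields iwasawa_atlas" "Y \<in> vfields iwasawa_atlas" "Z \<in> vfields iwasawa_atlas"
  shows "ext_deriv2 iwasawa_atlas (\<lambda>X. frame_metric (frame_acs X)) X Y Z x =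
    lie (components X x) (components Y x) \<bullet> acs0 (components Z x)
    - lie (components X x) (components Z x) \<bullet> acs0 (components Y x)
    + lie (components Y x) (components Z x) \<bullet> acs0 (components X x)"
proof -
  note c = assms[THEN smooth_map_components]
  note J = smooth_map_bounded_linear[OF bounded_linear_acs0]
  have "smooth_map (\<lambda>x. acs0 (a x) \<bullet> b x)" if "smooth_map a" "smooth_map b" for a b
    by (intro smooth_map_bounded_bilinear[OF bounded_bilinear_inner] J that)
  \<comment> \<open>Skewness moves \<open>acs0\<close> onto the differentiated factor in both terms,
    the shape in which the bracket terms of \<open>ext_deriv2\<close> cancel them.\<close>
  moreover have "along d (\<lambda>x. acs0 (a x) \<bullet> b x) x = acs0 (along d a x) \<bullet> b x - acs0 (along d b x) \<bullet> a x"
    if "smooth_map a" "smooth_map b" for a b d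
    using that J[OF that(1)] acs0_skew[of "along d b x" "a x"]
    by (simp add: along_bounded_bilinear[OF bounded_bilinear_inner]
        along_bounded_linear[OF bounded_linear_acs0] inner_commute)
  ultimately show ?thesis
    by (simp add: ext_deriv2_def frame_metric_def vderiv_eq_along assms c bracket_components
        frame_bracket_def acs0_linear inner_add_left inner_diff_left) (simp add: acs0_skew)
qed

text \<open>
  Koszul's formula on the frame:
  \<open>2 \<langle>lc0 a b, c\<rangle> = \<langle>lie a b, c\<rangle> - \<langle>lie b c, a\<rangle> + \<langle>lie c a, b\<rangle>\<close>.
\<close>

definition lc0 :: "complex3 \<Rightarrow> complex3 \<Rightarrow> complex3" where
  "lc0 a b = (1 / 2) *\<^sub>R
    (- (cnj (snd (snd b)) * fst (snd a)) - cnj (snd (snd a)) * fst (snd b),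
     snd (snd a) * fst b - snd (snd b) * fst a,
     cnj (fst b) * fst (snd a) + cnj (fst a) * fst (snd b))"

lemma bounded_bilinear_lc0: "bounded_bilinear lc0"
  unfolding bilinear_conv_bounded_bilinear[symmetric] bilinear_def lc0_def
  by (auto intro!: linearI simp: algebra_simps)

lemma lc0_skew: "lc0 a b \<bullet> c + b \<bullet> lc0 a c = 0"
  by (simp add: lc0_def inner_prod_def inner_complex_def algebra_simps)

lemma lc0_torsion: "lc0 a b - lc0 b a = lie a b"
  by (simp add: lc0_def lie_def prod_eq_iff complex_eq_iff algebra_simps)

text \<open>In the outer entries of \<open>lc0\<close> a middle entry meets a conjugated outer one,
  and either picks up -i; the middle entry is half that of \<open>lie\<close>. The factor is thus
  opposite to that of \<open>acs0\<close> everywhere.\<close>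

lemma lc0_acs0 [simp]: "lc0 (acs0 a) b = - acs0 (lc0 a b)" "lc0 a (acs0 b) = - acs0 (lc0 a b)"
  by (simp_all add: lc0_def acs0_def prod_eq_iff complex_eq_iff algebra_simps)

lemma levi_civita_frame: "levi_civita iwasawa_atlas frame_metric (frame_connection lc0)"
  unfolding levi_civita_def
  by (auto simp: torsion_frame lc0_torsion frame_field_zero
      intro: linear_connection_frame[OF bounded_bilinear_lc0] parallel_metric_frame[OF lc0_skew])

section \<open>Normal forms by type and the quasi-Kaehler condition\<close>

text \<open>A field of type (1,0) is determined by its imaginary part \<open>U\<close>, its real
  part being \<open>frame_acs U\<close>. This turns the extended tensors into real
  expressions.\<close>

lemma proj10_frame:
  assumes "Z \<in> cvfields iwasawa_atlas"
  obtains U where "U \<in> vfields iwasawa_atlas" "proj10 frame_acs Z = (frame_acs U, U)"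
proof
  have Z: "fst Z \<in> vfields iwasawa_atlas" "snd Z \<in> vfields iwasawa_atlas"
    using assms by (auto simp: cvfields_def)
  \<comment> \<open>The imaginary part of \<open>(Z - i J Z) / 2\<close>.\<close>
  let ?U = "fscale (\<lambda>_. 1 / 2) (snd Z - frame_acs (fst Z))"
  show U: "?U \<in> vfields iwasawa_atlas" by (simp add: Z smooth_map_const)
  have "frame_acs ?U = fscale (\<lambda>_. 1 / 2) (fst Z + frame_acs (snd Z))"
    by (rule vfields_iwasawa_eqI) (use U in \<open>simp_all add: Z smooth_map_const acs0_linear algebra_simps\<close>)
  then show "proj10 frame_acs Z = (frame_acs ?U, ?U)"
    by (simp add: proj10_def half_def mult_i_def extend_acs_def extend_field_def)
qed

lemma proj01_frame:
  assumes "Z \<in> cvfields iwasawa_atlas"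
  obtains U where "U \<in> vfields iwasawa_atlas" "proj01 frame_acs Z = (frame_acs U, - U)"
proof
  have Z: "fst Z \<in> vfields iwasawa_atlas" "snd Z \<in> vfields iwasawa_atlas"
    using assms by (auto simp: cvfields_def)
  \<comment> \<open>Minus the imaginary part of \<open>(Z + i J Z) / 2\<close>; the sign keeps the
    real part equal to \<open>frame_acs U\<close>.\<close>
  let ?U = "- fscale (\<lambda>_. 1 / 2) (snd Z + frame_acs (fst Z))"
  show U: "?U \<in> vfields iwasawa_atlas" by (simp add: Z smooth_map_const)
  have "frame_acs ?U = fscale (\<lambda>_. 1 / 2) (fst Z - frame_acs (snd Z))"
    by (rule vfields_iwasawa_eqI) (use U in \<open>simp_all add: Z smooth_map_const acs0_linear algebra_simps\<close>)
  then show "proj01 frame_acs Z = (frame_acs ?U, - ?U)"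
    by (simp add: proj01_def half_def mult_i_def extend_acs_def extend_field_def)
qed

lemmas lie_minus = bounded_bilinear.minus_left[OF bounded_bilinear_lie]
  bounded_bilinear.minus_right[OF bounded_bilinear_lie]

lemmas lc0_minus = bounded_bilinear.minus_left[OF bounded_bilinear_lc0]
  bounded_bilinear.minus_right[OF bounded_bilinear_lc0]

text \<open>Let T10 and T01 be the eigenspaces of \<open>acs0\<close> for i and -i. Antilinearity
  gives \<open>lie\<close> of T10 with T01 equal to zero and \<open>lie\<close> of T01 with itself
  inside T10, which the metric pairs with T10 to zero. So each summand of
  \<open>ext_deriv2_frame\<close> vanishes on type (1,2).\<close>

lemma quasi_kaehler_frame:
  "quasi_kaehler iwasawa_atlas frame_metric frame_acs (\<lambda>X. frame_metric (frame_acs X))"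
  unfolding quasi_kaehler_def
proof (intro conjI ballI allI almost_hermitian_frame)
  fix Z1 Z2 Z3 x
  assume Z: "Z1 \<in> cvfields iwasawa_atlas" "Z2 \<in> cvfields iwasawa_atlas" "Z3 \<in> cvfields iwasawa_atlas"
  obtain U1 U2 U3 where
    "U1 \<in> vfields iwasawa_atlas" "proj10 frame_acs Z1 = (frame_acs U1, U1)"
    "U2 \<in> vfields iwasawa_atlas" "proj10 frame_acs Z2 = (frame_acs U2, U2)"
    "U3 \<in> vfields iwasawa_atlas" "proj10 frame_acs Z3 = (frame_acs U3, U3)"
    using Z[THEN proj10_frame] by metis
  moreover obtain W1 W2 W3 where
    "W1 \<in> vfields iwasawa_atlas" "proj01 frame_acs Z1 = (frame_acs W1, - W1)"
    "W2 \<in> vfields iwasawa_atlas" "proj01 frame_acs Z2 = (frame_acs W2, - W2)"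
    "W3 \<in> vfields iwasawa_atlas" "proj01 frame_acs Z3 = (frame_acs W3, - W3)"
    using Z[THEN proj01_frame] by metis
  ultimately show "part12 frame_acs (ext_deriv2 iwasawa_atlas (\<lambda>X. frame_metric (frame_acs X))) Z1 Z2 Z3 x = 0"
    by (simp add: part12_def extend3_def extend_def ext_deriv2_frame complex_eq_iff
        lie_minus acs0_linear acs0_skew)
qed

lemma extend_bilinear_eq:
  "extend_bilinear T (X, Y) (X', Y') = (T X X' - T Y Y', T X Y' + T Y X')"
  by (simp add: extend_bilinear_def extend_field_def mult_i_def)

lemma bounded_bilinear_zero: "bounded_bilinear (\<lambda>a b. 0)"
  by (rule bounded_bilinear.intro) (auto intro: exI[of _ 0])

text \<open>Metric and \<open>acs0\<close> are constant in the frame, hence parallel. The torsion is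
  minus \<open>lie\<close>, which vanishes between T10 and T01.\<close>

lemma canonical_connection_frame:
  "canonical_connection iwasawa_atlas frame_metric frame_acs (frame_connection (\<lambda>a b. 0))"
  unfolding canonical_connection_def
proof (intro conjI ballI)
  show "linear_connection iwasawa_atlas (frame_connection (\<lambda>a b. 0))"
    by (rule linear_connection_frame) (rule bounded_bilinear_zero)
  show "parallel_metric iwasawa_atlas frame_metric (frame_connection (\<lambda>a b. 0))"
    by (rule parallel_metric_frame) simp
  show "parallel_acs iwasawa_atlas frame_acs (frame_connection (\<lambda>a b. 0))"
    unfolding parallel_acs_def
    by (simp add: frame_connection_def frame_acs_def smooth_map_components
        along_bounded_linear[OF bounded_linear_acs0])
next
  let ?T = "torsion iwasawa_atlas (frame_connection (\<lambda>a b. 0))"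
  fix Z1 Z2
  assume Z: "Z1 \<in> cvfields iwasawa_atlas" "Z2 \<in> cvfields iwasawa_atlas"
  obtain U1 U2 where
    "U1 \<in> vfields iwasawa_atlas" "proj10 frame_acs Z1 = (frame_acs U1, U1)"
    "U2 \<in> vfields iwasawa_atlas" "proj10 frame_acs Z2 = (frame_acs U2, U2)"
    using Z[THEN proj10_frame] by metis
  moreover obtain W1 W2 where
    "W1 \<in> vfields iwasawa_atlas" "proj01 frame_acs Z1 = (frame_acs W1, - W1)"
    "W2 \<in> vfields iwasawa_atlas" "proj01 frame_acs Z2 = (frame_acs W2, - W2)"
    using Z[THEN proj01_frame] by metis
  ultimately have "part11 frame_acs ?T Z1 Z2 = (0, 0)"
    by (simp add: part11_def extend_bilinear_eq torsion_frame lie_minus acs0_linear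
        frame_field_minus)
  then show "part11 frame_acs ?T Z1 Z2 = 0" by (simp add: zero_prod_def)
qed

section \<open>The second Gray identity\<close>

lemma vfields10_frame:
  assumes "Z \<in> vfields10 iwasawa_atlas frame_acs"
  obtains U where "U \<in> vfields iwasawa_atlas" "Z = (frame_acs U, U)"
proof
  show "snd Z \<in> vfields iwasawa_atlas" using assms by (auto simp: vfields10_def cvfields_def)
  show "Z = (frame_acs (snd Z), snd Z)"
    using assms by (auto simp: vfields10_def extend_acs_def extend_field_def mult_i_def prod_eq_iff)
qed

text \<open>\<open>lc0\<close> and \<open>lie\<close> both send T10 with T10 to T01, T01 with T01 to
  T10, and mixed types to zero. With four arguments in T10, every term of
  \<open>frame_curvature\<close> contains a mixed product. With the first conjugated, the terms
  through \<open>lc0 a c\<close> and \<open>lie a b\<close> are zero, and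
  \<open>lc0 a (lc0 b c)\<close> lies in T10, so its product with the fourth argument
  vanishes.\<close>

lemma second_gray_identity_frame:
  assumes "Z1 \<in> vfields10 iwasawa_atlas frame_acs" "Z2 \<in> vfields10 iwasawa_atlas frame_acs"
    "Z3 \<in> vfields10 iwasawa_atlas frame_acs" "Z4 \<in> vfields10 iwasawa_atlas frame_acs"
  shows "extend4 (curvature iwasawa_atlas frame_metric (frame_connection lc0)) Z1 Z2 Z3 Z4 x = 0"
    and "extend4 (curvature iwasawa_atlas frame_metric (frame_connection lc0)) (conj_field Z1) Z2 Z3 Z4 x = 0"
proof -
  obtain U1 U2 U3 U4 where U:
    "U1 \<in> vfields iwasawa_atlas" "Z1 = (frame_acs U1, U1)"
    "U2 \<in> vfields iwasawa_atlas" "Z2 = (frame_acs U2, U2)"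
    "U3 \<in> vfields iwasawa_atlas" "Z3 = (frame_acs U3, U3)"
    "U4 \<in> vfields iwasawa_atlas" "Z4 = (frame_acs U4, U4)"
    using assms[THEN vfields10_frame] by metis
  note R = curvature_frame[OF bounded_bilinear_lc0]
  show "extend4 (curvature iwasawa_atlas frame_metric (frame_connection lc0)) Z1 Z2 Z3 Z4 x = 0"
    by (simp add: U extend4_def extend_def R frame_curvature_def complex_eq_iff
        lie_minus lc0_minus acs0_linear acs0_skew inner_diff_left inner_add_left)
  show "extend4 (curvature iwasawa_atlas frame_metric (frame_connection lc0)) (conj_field Z1) Z2 Z3 Z4 x = 0"
    by (simp add: U conj_field_def extend4_def extend_def R frame_curvature_def complex_eq_iff
        lie_minus lc0_minus acs0_linear acs0_skew inner_diff_left inner_add_left)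
qed

theorem theorem4p3:
  shows "\<exists>g0 J0 \<omega>0. quasi_kaehler iwasawa_atlas g0 J0 \<omega>0 \<and>
    (\<exists>D. canonical_connection iwasawa_atlas g0 J0 D \<and>
      (\<forall>X\<in>vfields iwasawa_atlas. \<forall>Y\<in>vfields iwasawa_atlas.
       \<forall>Z\<in>vfields iwasawa_atlas. \<forall>W\<in>vfields iwasawa_atlas. \<forall>x.
         curvature iwasawa_atlas g0 D X Y Z W x = 0)) \<and>
    (\<exists>D. levi_civita iwasawa_atlas g0 D \<and>
      (\<forall>Z1\<in>vfields10 iwasawa_atlas J0. \<forall>Z2\<in>vfields10 iwasawa_atlas J0.
       \<forall>Z3\<in>vfields10 iwasawa_atlas J0. \<forall>Z4\<in>vfields10 iwasawa_atlas J0. \<forall>x.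
         extend4 (curvature iwasawa_atlas g0 D) Z1 Z2 Z3 Z4 x = 0 \<and>
         extend4 (curvature iwasawa_atlas g0 D) (conj_field Z1) Z2 Z3 Z4 x = 0))"
proof (intro exI conjI ballI allI)
  show "quasi_kaehler iwasawa_atlas frame_metric frame_acs (\<lambda>X. frame_metric (frame_acs X))"
    by (rule quasi_kaehler_frame)
  show "canonical_connection iwasawa_atlas frame_metric frame_acs (frame_connection (\<lambda>a b. 0))"
    by (rule canonical_connection_frame)
  show "curvature iwasawa_atlas frame_metric (frame_connection (\<lambda>a b. 0)) X Y Z W x = 0"
    if "X \<in> vfields iwasawa_atlas" "Y \<in> vfields iwasawa_atlas" "Z \<in> vfields iwasawa_atlas" for X Y Z W x
    using that by (simp add: curvature_frame[OF bounded_bilinear_zero] frame_curvature_def)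
  show "levi_civita iwasawa_atlas frame_metric (frame_connection lc0)"
    by (rule levi_civita_frame)
qed (rule second_gray_identity_frame; assumption)+

end
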